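(* Let $M$ be a connected and complete Riemannian manifold, let $I(M)$ be its full isometry group, and let $G\subset I(M)$ be a subgroup. Then $G$ acts properly on $M$ if and only if $G$ is closed in $I(M)$.
   Context: $I(M)$ carries its usual Lie group topology (the compact-open topology, i.e. uniform convergence on compact sets), and a subgroup $G\subset I(M)$ (not assumed closed) carries the subspace topology. $G$ acts on $M$ by $(g,p)\mapsto g(p)$. The action of $G$ on $M$ is called proper if one (and hence all) of the following equivalent conditions holds: (i) the map $G\times M\to M\times M$, $(g,p)\mapsto(g(p),p)$, is proper; (ii) for all compact subsets $K,L$ of $M$, the set $\{g\in G: g(K)\cap L\neq\emptyset\}$ is compact; (iii) for any two points $p,q\in M$ there exist open neighborhoods $U_p$ of $p$ and $V_q$ of $q$ such that $\{g\in G: g(U_p)\cap V_q\neq\emptyset\}$ is relatively compact in $G$; (iv) for any sequences $\{g_n\}\subset G$ and $\{p_n\}\subset M$, if $g_n(p_n)\to q$ and $p_n\to p$ for some $p,q\in M$, then $\{g_n\}$ has a subsequence converging in $G$. *)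

theory Defs
  imports "HOL-Analysis.Analysis" "HOL-Algebra.Group"
begin

section \<open>Smooth manifolds\<close>

text \<open>
  The set \<open>S\<close> is meant to be open in the following two definitions.
\<close>

primrec times_differentiable_on ::
  "nat \<Rightarrow> ('a::euclidean_space \<Rightarrow> 'b::real_normed_vector) \<Rightarrow> 'a set \<Rightarrow> bool" where
  "times_differentiable_on 0 f S \<longleftrightarrow> continuous_on S f"
| "times_differentiable_on (Suc k) f S \<longleftrightarrow>
     (\<forall>x\<in>S. f differentiable (at x)) \<and>
     (\<forall>v. times_differentiable_on k (\<lambda>x. frechet_derivative f (at x) v) S)"

definition smooth_on :: "('a::euclidean_space \<Rightarrow> 'b::real_normed_vector) \<Rightarrow> 'a set \<Rightarrow> bool" where
  "smooth_on f S \<longleftrightarrow> (\<forall>k. times_differentiable_on k f S)"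

text \<open>
  The manifold is the whole type \<open>'m\<close>, with the topology given by its type class, and is
  modelled on the Euclidean space \<open>'e\<close>. A chart is a pair of a domain and a coordinate map, the
  latter being irrelevant outside the domain. An atlas need not be maximal.
\<close>

type_synonym ('m, 'e) chart = "'m set \<times> ('m \<Rightarrow> 'e)"

abbreviation dom_of :: "('m, 'e) chart \<Rightarrow> 'm set" where
  "dom_of c \<equiv> fst c"

abbreviation coord :: "('m, 'e) chart \<Rightarrow> 'm \<Rightarrow> 'e" where
  "coord c \<equiv> snd c"

definition param :: "('m, 'e) chart \<Rightarrow> 'e \<Rightarrow> 'm" where
  "param c = inv_into (dom_of c) (coord c)"

definition is_chart :: "('m::topological_space, 'e::euclidean_space) chart \<Rightarrow> bool" where
  "is_chart c \<longleftrightarrow> open (dom_of c) \<and> open (coord c ` dom_of c) \<and>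
     homeomorphism (dom_of c) (coord c ` dom_of c) (coord c) (param c)"

definition smooth_atlas :: "('m::topological_space, 'e::euclidean_space) chart set \<Rightarrow> bool" where
  "smooth_atlas A \<longleftrightarrow>
     (\<forall>c\<in>A. is_chart c) \<and> (\<Union>c\<in>A. dom_of c) = UNIV \<and>
     (\<forall>c\<in>A. \<forall>d\<in>A. smooth_on (coord d \<circ> param c) (coord c ` (dom_of c \<inter> dom_of d)))"

definition smooth_map ::
  "('m::topological_space, 'e::euclidean_space) chart set \<Rightarrow> ('m \<Rightarrow> 'm) \<Rightarrow> bool" where
  "smooth_map A f \<longleftrightarrow> continuous_on UNIV f \<and>
     (\<forall>c\<in>A. \<forall>d\<in>A. smooth_on (coord d \<circ> f \<circ> param c) (coord c ` (dom_of c \<inter> f -` dom_of d)))"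

text \<open>
  The differential of \<open>f\<close> at \<open>p\<close>, written in the charts \<open>c\<close> around \<open>p\<close> and \<open>d\<close> around \<open>f p\<close>.
  For \<open>f = id\<close> it is the change of the components of a tangent vector from \<open>c\<close> to \<open>d\<close>.
\<close>

definition differential ::
  "('m, 'e::euclidean_space) chart \<Rightarrow> ('m, 'e) chart \<Rightarrow> ('m \<Rightarrow> 'm) \<Rightarrow> 'm \<Rightarrow> 'e \<Rightarrow> 'e" where
  "differential c d f p = frechet_derivative (coord d \<circ> f \<circ> param c) (at (coord c p))"

section \<open>Riemannian manifolds\<close>

text \<open>
  A metric tensor is given by its local expressions: \<open>g c p u v\<close> is the inner product of the
  tangent vectors at \<open>p\<close> with components \<open>u\<close> and \<open>v\<close> in the chart \<open>c\<close>, where \<open>p \<in> dom_of c\<close>.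
  Each \<open>g c p\<close> is an inner product on \<open>'e\<close>, its dependence on \<open>p\<close> is smooth, and the
  local expressions are related by the transformation law of covariant 2-tensors.
\<close>

type_synonym ('m, 'e) metric_tensor = "('m, 'e) chart \<Rightarrow> 'm \<Rightarrow> 'e \<Rightarrow> 'e \<Rightarrow> real"

definition riemannian_metric ::
  "('m::topological_space, 'e::euclidean_space) chart set \<Rightarrow> ('m, 'e) metric_tensor \<Rightarrow> bool" where
  "riemannian_metric A g \<longleftrightarrow>
     (\<forall>c\<in>A. \<forall>p\<in>dom_of c. bilinear (g c p) \<and>
        (\<forall>u v. g c p u v = g c p v u) \<and> (\<forall>u. u \<noteq> 0 \<longrightarrow> g c p u u > 0)) \<and>
     (\<forall>c\<in>A. \<forall>u v. smooth_on (\<lambda>x. g c (param c x) u v) (coord c ` dom_of c)) \<and>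
     (\<forall>c\<in>A. \<forall>d\<in>A. \<forall>p\<in>dom_of c \<inter> dom_of d. \<forall>u v.
        g d p (differential c d id p u) (differential c d id p v) = g c p u v)"

text \<open>
  \<open>euclidean_space\<close> types have positive dimension, so manifolds of dimension 0 are not covered.
\<close>

definition riemannian_manifold ::
  "('m::{second_countable_topology,t2_space}, 'e::euclidean_space) chart set \<Rightarrow>
   ('m, 'e) metric_tensor \<Rightarrow> bool" where
  "riemannian_manifold A g \<longleftrightarrow> smooth_atlas A \<and> riemannian_metric A g"

section \<open>Riemannian distance and completeness\<close>

definition C1_curve_on ::
  "('m::topological_space, 'e::euclidean_space) chart set \<Rightarrow> real \<Rightarrow> real \<Rightarrow> (real \<Rightarrow> 'm) \<Rightarrow> bool" where
  "C1_curve_on A a b \<gamma> \<longleftrightarrow> continuous_on {a..b} \<gamma> \<and>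
     (\<forall>c\<in>A. \<exists>\<gamma>'. continuous_on ({a..b} \<inter> \<gamma> -` dom_of c) \<gamma>' \<and>
        (\<forall>t\<in>{a..b} \<inter> \<gamma> -` dom_of c.
           ((coord c \<circ> \<gamma>) has_vector_derivative \<gamma>' t) (at t within {a..b})))"

text \<open>
  \<open>T\<close> contains the break points; the curve is \<open>C\<^sup>1\<close> up to the end points of each piece, so that
  its speed is bounded and integrable.
\<close>

definition piecewise_C1_curve_on ::
  "('m::topological_space, 'e::euclidean_space) chart set \<Rightarrow> real \<Rightarrow> real \<Rightarrow> (real \<Rightarrow> 'm) \<Rightarrow> bool" where
  "piecewise_C1_curve_on A a b \<gamma> \<longleftrightarrow> continuous_on {a..b} \<gamma> \<and>
     (\<exists>T. finite T \<and>
        (\<forall>s t. a \<le> s \<and> s < t \<and> t \<le> b \<and> {s<..<t} \<inter> T = {} \<longrightarrow> C1_curve_on A s t \<gamma>))"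

text \<open>
  By the transformation law, the speed does not depend on the chosen chart. Its values at the
  finitely many break and end points do not affect the length.
\<close>

definition speed ::
  "('m::topological_space, 'e::euclidean_space) chart set \<Rightarrow> ('m, 'e) metric_tensor \<Rightarrow>
   (real \<Rightarrow> 'm) \<Rightarrow> real \<Rightarrow> real" where
  "speed A g \<gamma> t =
     (let c = (SOME c. c \<in> A \<and> \<gamma> t \<in> dom_of c);
          v = vector_derivative (coord c \<circ> \<gamma>) (at t)
      in sqrt (g c (\<gamma> t) v v))"

definition curve_length ::
  "('m::topological_space, 'e::euclidean_space) chart set \<Rightarrow> ('m, 'e) metric_tensor \<Rightarrow>
   (real \<Rightarrow> 'm) \<Rightarrow> real" where
  "curve_length A g \<gamma> = integral {0..1} (speed A g \<gamma>)"

text \<open>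
  The infimum is over a nonempty set whenever the manifold is connected.
\<close>

definition riemannian_dist ::
  "('m::topological_space, 'e::euclidean_space) chart set \<Rightarrow> ('m, 'e) metric_tensor \<Rightarrow>
   'm \<Rightarrow> 'm \<Rightarrow> real" where
  "riemannian_dist A g p q =
     Inf {curve_length A g \<gamma> |\<gamma>. piecewise_C1_curve_on A 0 1 \<gamma> \<and> \<gamma> 0 = p \<and> \<gamma> 1 = q}"

definition complete_riemannian ::
  "('m::topological_space, 'e::euclidean_space) chart set \<Rightarrow> ('m, 'e) metric_tensor \<Rightarrow> bool" where
  "complete_riemannian A g \<longleftrightarrow> Metric_space.mcomplete UNIV (riemannian_dist A g)"

section \<open>The isometry group\<close>

definition isometries ::
  "('m::topological_space, 'e::euclidean_space) chart set \<Rightarrow> ('m, 'e) metric_tensor \<Rightarrow>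
   ('m \<Rightarrow> 'm) set" where
  "isometries A g =
     {f. bij f \<and> smooth_map A f \<and> smooth_map A (inv_into UNIV f) \<and>
         (\<forall>c\<in>A. \<forall>d\<in>A. \<forall>p\<in>dom_of c \<inter> f -` dom_of d. \<forall>u v.
            g d (f p) (differential c d f p u) (differential c d f p v) = g c p u v)}"

definition isometry_group ::
  "('m::topological_space, 'e::euclidean_space) chart set \<Rightarrow> ('m, 'e) metric_tensor \<Rightarrow>
   ('m \<Rightarrow> 'm) monoid" where
  "isometry_group A g = \<lparr>carrier = isometries A g, mult = (\<circ>), one = id\<rparr>"

definition compact_open_topology ::
  "('a::topological_space \<Rightarrow> 'b::topological_space) topology" where
  "compact_open_topology = topology_generated_by
     {{f. continuous_on UNIV f \<and> f ` K \<subseteq> U} |K U. compact K \<and> open U}"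

definition isometry_topology ::
  "('m::topological_space, 'e::euclidean_space) chart set \<Rightarrow> ('m, 'e) metric_tensor \<Rightarrow>
   ('m \<Rightarrow> 'm) topology" where
  "isometry_topology A g = subtopology compact_open_topology (isometries A g)"

section \<open>Proper actions\<close>

text \<open>
  The topology \<open>T\<close> is the one on the acting group of transformations, which is its
  \<open>topspace\<close>. The library's \<open>proper_map\<close> means closed with compact fibres; for a continuous map
  into a locally compact Hausdorff space, such as here, this says that preimages of compact
  sets are compact.
\<close>

definition acts_properly :: "('m::topological_space \<Rightarrow> 'm) topology \<Rightarrow> bool" where
  "acts_properly T \<longleftrightarrow>
     proper_map (prod_topology T euclidean) (prod_topology euclidean euclidean)
       (\<lambda>(h, p). (h p, p))"

end

theory Submission
  imports Defs
begin

text \<open>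
  The only metric input is a local one: isometries map short segments in charts to short curves.
  Hence if an isometry sends some point near \<open>x\<close> to a point near \<open>y\<close>, it sends a whole fixed
  neighbourhood of \<open>x\<close> into a small neighbourhood of \<open>y\<close> (even continuity). On a connected
  locally compact space, this alone implies that if the images of one point under a family of
  elements of \<open>G\<close> stay in a compact set, then so do the images of every other point, and that the
  compact-open topology on the isometries is the topology of pointwise convergence. By Tychonoff's
  theorem, the elements of a closed subgroup \<open>G\<close> that move a compact set to one meeting another
  compact set then form a compact set, provided that pointwise limits of isometries are isometries.
  For the latter, the Hessian of an isometry is a smooth function of the point, the value and the
  first derivative, so that bounds on first derivatives bound the second ones; therefore the first
  derivatives converge too, the limit satisfies the same equation, and it is smooth by
  bootstrapping.

  Conversely, for a proper action, the elements of \<open>G\<close> that move a given point into a compact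
  neighbourhood of its image under a limit point of \<open>G\<close> form a compact, hence closed set, so that
  this limit point belongs to \<open>G\<close>.
\<close>

section \<open>Calculus of smooth maps\<close>

text \<open>Two obstacles shape the compactness proof. A pointwise limit of bijections need not be
  bijective, so compactness is proved for the set of pairs of a transformation and its inverse,
  inside a product of two function spaces: the two components of a limit pair are still inverse to
  each other. Moreover, a point of the closure in the product topology is not given as the limit of
  a sequence, while the convergence of derivatives is a statement about sequences. Even continuity
  bridges this gap: closeness at finitely many points forces uniform closeness on a compact
  coordinate ball, so on each small ball some sequence of isometries converges uniformly.

  The derivatives then converge by interpolation, because the difference of two members of the
  sequence is small and has bounded second derivatives. The Hessian is solved for by raising an
  index with the metric of the source. The result is polynomial in the first derivative and contains
  no inverse of it, which makes it continuous up to the limit and fit for bootstrapping.\<close>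

abbreviation dird :: "('a::euclidean_space \<Rightarrow> 'b::real_normed_vector) \<Rightarrow> 'a \<Rightarrow> 'a \<Rightarrow> 'b" where
  "dird f v x \<equiv> frechet_derivative f (at x) v"

lemma has_derivative_transform_open:
  assumes "(f has_derivative f') (at x)" "open S" "x \<in> S" "\<And>y. y \<in> S \<Longrightarrow> g y = f y"
  shows "(g has_derivative f') (at x)"
  using has_derivative_transform_within_open[of f f' x UNIV S g] assms by auto

text \<open>\<open>frechet_derivative\<close> is a choice of some derivative. The sets of admissible
  derivatives of \<open>f\<close> and \<open>g\<close> coincide, hence so do the choices, even at
  points where no derivative exists.\<close>

lemma frechet_derivative_cong_open:
  assumes "open S" "x \<in> S" "\<And>y. y \<in> S \<Longrightarrow> f y = g y"
  shows "frechet_derivative f (at x) = frechet_derivative g (at x)"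
proof -
  have "(f has_derivative D) (at x) \<longleftrightarrow> (g has_derivative D) (at x)" for D
    using has_derivative_transform_open[of f D x S g] has_derivative_transform_open[of g D x S f] assms
    by auto
  then show ?thesis unfolding frechet_derivative_def by simp
qed

lemma times_differentiable_on_cong:
  assumes "open S" "\<And>x. x \<in> S \<Longrightarrow> f x = g x" "times_differentiable_on k f S"
  shows "times_differentiable_on k g S"
  using assms(2,3)
proof (induction k arbitrary: f g)
  case 0
  then show ?case by (simp cong: continuous_on_cong)
next
  case (Suc k)
  have d: "g differentiable (at x)" if x: "x \<in> S" for x
  proof -
    obtain D where "(f has_derivative D) (at x)"
      using Suc.prems(2) x by (auto simp: differentiable_def)
    then have "(g has_derivative D) (at x)"
      by (rule has_derivative_transform_open[OF _ assms(1) x]) (simp add: Suc.prems(1))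
    then show ?thesis by (auto simp: differentiable_def)
  qed
  have "dird f v x = dird g v x" if "x \<in> S" for x v
    using frechet_derivative_cong_open[OF assms(1) that Suc.prems(1)] by simp
  then have "times_differentiable_on k (dird g v) S" for v
    using Suc.IH[of "dird f v" "dird g v"] Suc.prems(2) by auto
  then show ?case using d by simp
qed

lemma times_differentiable_on_imp_continuous_on:
  "times_differentiable_on k f S \<Longrightarrow> continuous_on S f"
  by (cases k) (auto intro!: continuous_at_imp_continuous_on differentiable_imp_continuous_within)

lemma times_differentiable_on_Suc_imp:
  "times_differentiable_on (Suc k) f S \<Longrightarrow> times_differentiable_on k f S"
proof (induction k arbitrary: f)
  case 0
  from times_differentiable_on_imp_continuous_on[OF this] show ?case by simp
next
  case (Suc k)
  then show ?case by (metis times_differentiable_on.simps(2))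
qed

lemma times_differentiable_on_subset:
  "times_differentiable_on k f S \<Longrightarrow> T \<subseteq> S \<Longrightarrow> times_differentiable_on k f T"
  by (induction k arbitrary: f) (auto intro: continuous_on_subset)

text \<open>Derivatives are taken \<open>at x\<close> and not within \<open>S\<close>, so each
  clause can be checked in a neighbourhood of one point. This reduces the smoothness of a limit to
  small coordinate balls.\<close>

lemma times_differentiable_on_local:
  assumes "\<And>x. x \<in> S \<Longrightarrow> \<exists>U. open U \<and> x \<in> U \<and> times_differentiable_on k f U"
  shows "times_differentiable_on k f S"
  using assms
proof (induction k arbitrary: f)
  case 0
  have "isCont f x" if x: "x \<in> S" for x
    using 0[OF that] by (auto simp: continuous_on_eq_continuous_at)
  then show ?case by (simp add: continuous_at_imp_continuous_on)
next
  case (Suc k)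
  then show ?case by simp metis
qed

lemma times_differentiable_on_const: "times_differentiable_on k (\<lambda>x. c) S"
proof (induction k arbitrary: c)
  case (Suc k)
  have "dird (\<lambda>x. c) v = (\<lambda>x. 0)" for v :: 'a
    by (metis frechet_derivative_const)
  then show ?case using Suc by simp
qed auto

text \<open>Derivatives are unique, so an explicit formula may replace the chosen value
  \<open>frechet_derivative\<close>. This is the induction step of the regularity proofs
  below.\<close>

lemma times_differentiable_on_SucI:
  assumes "open S" "\<And>x. x \<in> S \<Longrightarrow> (f has_derivative f' x) (at x)"
    "\<And>v. times_differentiable_on k (\<lambda>x. f' x v) S"
  shows "times_differentiable_on (Suc k) f S"
proof -
  have eq: "f' x v = dird f v x" if "x \<in> S" for x v
    by (metis assms(2) frechet_derivative_at that)
  then have "times_differentiable_on k (dird f v) S" for v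
    using times_differentiable_on_cong[OF assms(1) _ assms(3)[of v], of "dird f v"] by blast
  then show ?thesis using assms(2) by (auto simp: differentiable_def)
qed

lemma times_differentiable_on_SucD:
  assumes "times_differentiable_on (Suc k) f S" "x \<in> S"
  shows "(f has_derivative (\<lambda>v. dird f v x)) (at x)"
  using assms frechet_derivative_works by fastforce

lemma times_differentiable_on_add:
  assumes "open S" "times_differentiable_on k f S" "times_differentiable_on k g S"
  shows "times_differentiable_on k (\<lambda>x. f x + g x) S"
  using assms(2,3)
proof (induction k arbitrary: f g)
  case (Suc k)
  show ?case
  proof (rule times_differentiable_on_SucI[OF assms(1)])
    fix x assume "x \<in> S"
    then show "((\<lambda>x. f x + g x) has_derivative (\<lambda>v. dird f v x + dird g v x)) (at x)"
      by (intro has_derivative_add times_differentiable_on_SucD[OF Suc.prems(1)]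
          times_differentiable_on_SucD[OF Suc.prems(2)])
  qed (use Suc in auto)
qed (auto intro: continuous_intros)

lemma times_differentiable_on_sum:
  assumes "open S" "\<And>i. i \<in> I \<Longrightarrow> times_differentiable_on k (f i) S"
  shows "times_differentiable_on k (\<lambda>x. \<Sum>i\<in>I. f i x) S"
  using assms(2)
  by (induction I rule: infinite_finite_induct)
    (auto simp: times_differentiable_on_const intro: times_differentiable_on_add assms(1))

lemma (in bounded_bilinear) times_differentiable_on:
  assumes "open S" "times_differentiable_on k f S" "times_differentiable_on k g S"
  shows "times_differentiable_on k (\<lambda>x. prod (f x) (g x)) S"
  using assms(2,3)
proof (induction k arbitrary: f g)
  case (Suc k)
  show ?case
  proof (rule times_differentiable_on_SucI[OF assms(1)])
    fix x assume "x \<in> S"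
    then show "((\<lambda>x. prod (f x) (g x)) has_derivative (\<lambda>v. prod (f x) (dird g v x) + prod (dird f v x) (g x))) (at x)"
      by (intro FDERIV times_differentiable_on_SucD[OF Suc.prems(1)]
          times_differentiable_on_SucD[OF Suc.prems(2)])
  next
    fix v
    show "times_differentiable_on k (\<lambda>x. prod (f x) (dird g v x) + prod (dird f v x) (g x)) S"
      using Suc by (intro times_differentiable_on_add assms(1) Suc.IH)
        (use times_differentiable_on_Suc_imp[OF Suc.prems(1)] times_differentiable_on_Suc_imp[OF Suc.prems(2)] in auto)
  qed
qed (auto intro: continuous_on)

lemmas times_differentiable_on_mult =
  bounded_bilinear.times_differentiable_on[OF bounded_bilinear_mult]
lemmas times_differentiable_on_scaleR =
  bounded_bilinear.times_differentiable_on[OF bounded_bilinear_scaleR]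
lemmas times_differentiable_on_inner =
  bounded_bilinear.times_differentiable_on[OF bounded_bilinear_inner]

lemma times_differentiable_on_diff:
  fixes f g :: "'a::euclidean_space \<Rightarrow> 'b::real_normed_vector"
  assumes "open S" "times_differentiable_on k f S" "times_differentiable_on k g S"
  shows "times_differentiable_on k (\<lambda>x. f x - g x) S"
proof -
  have "times_differentiable_on k (\<lambda>x. (-1) *\<^sub>R g x) S"
    using times_differentiable_on_scaleR[OF assms(1) times_differentiable_on_const assms(3)] .
  from times_differentiable_on_add[OF assms(1,2) this] show ?thesis by simp
qed

text \<open>The chain rule produces the derivative of \<open>f\<close> in the direction
  \<open>dird \<phi> v x\<close>, which varies with \<open>x\<close>. Expanding this direction in
  the basis leaves derivatives in fixed directions, composed with \<open>\<phi>\<close>, to which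
  the induction hypothesis applies.\<close>

lemma times_differentiable_on_compose:
  fixes f :: "'b::euclidean_space \<Rightarrow> 'c::real_normed_vector" and \<phi> :: "'a::euclidean_space \<Rightarrow> 'b"
  assumes "open S" "open T" "\<phi> ` S \<subseteq> T" "times_differentiable_on k f T" "times_differentiable_on k \<phi> S"
  shows "times_differentiable_on k (\<lambda>x. f (\<phi> x)) S"
  using assms(4,5)
proof (induction k arbitrary: f)
  case 0
  then show ?case using continuous_on_compose2[of T f S \<phi>] assms(3) by simp
next
  case (Suc k)
  show ?case
  proof (rule times_differentiable_on_SucI[OF assms(1)])
    fix x assume x: "x \<in> S"
    then have "\<phi> x \<in> T" using assms(3) by auto
    note F = times_differentiable_on_SucD[OF Suc.prems(1) this]
    then have lin: "linear (frechet_derivative f (at (\<phi> x)))"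
      using has_derivative_linear by blast
    have "((\<lambda>x. f (\<phi> x)) has_derivative (\<lambda>v. dird f (dird \<phi> v x) (\<phi> x))) (at x)"
      using has_derivative_compose[OF times_differentiable_on_SucD[OF Suc.prems(2) x] F] .
    moreover have "dird f (dird \<phi> v x) (\<phi> x) = (\<Sum>b\<in>Basis. (dird \<phi> v x \<bullet> b) *\<^sub>R dird f b (\<phi> x))" for v
      by (subst euclidean_representation[of "dird \<phi> v x", symmetric])
        (simp only: linear_sum[OF lin] linear_scale[OF lin])
    ultimately show "((\<lambda>x. f (\<phi> x)) has_derivative
        (\<lambda>v. \<Sum>b\<in>Basis. (dird \<phi> v x \<bullet> b) *\<^sub>R dird f b (\<phi> x))) (at x)" by simp
  next
    fix v
    show "times_differentiable_on k (\<lambda>x. \<Sum>b\<in>Basis. (dird \<phi> v x \<bullet> b) *\<^sub>R dird f b (\<phi> x)) S"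
      using Suc.prems times_differentiable_on_Suc_imp[OF Suc.prems(2)]
      by (intro times_differentiable_on_sum times_differentiable_on_scaleR times_differentiable_on_inner
          times_differentiable_on_const assms(1) Suc.IH) auto
  qed
qed

section \<open>Smooth functions and the symmetry of second derivatives\<close>

lemma smooth_on_dird: "smooth_on f S \<Longrightarrow> smooth_on (dird f v) S"
  unfolding smooth_on_def by (metis times_differentiable_on.simps(2))

lemma smooth_on_has_derivative:
  "smooth_on f S \<Longrightarrow> x \<in> S \<Longrightarrow> (f has_derivative (\<lambda>v. dird f v x)) (at x)"
  unfolding smooth_on_def using times_differentiable_on_SucD by blast

lemma smooth_on_continuous_on: "smooth_on f S \<Longrightarrow> continuous_on S f"
  unfolding smooth_on_def using times_differentiable_on_imp_continuous_on by blast

lemma smooth_on_subset: "smooth_on f S \<Longrightarrow> T \<subseteq> S \<Longrightarrow> smooth_on f T"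
  unfolding smooth_on_def using times_differentiable_on_subset by blast

lemma smooth_on_inner_left:
  "open S \<Longrightarrow> smooth_on f S \<Longrightarrow> smooth_on (\<lambda>x. f x \<bullet> b) S"
  unfolding smooth_on_def
  by (auto intro!: times_differentiable_on_inner times_differentiable_on_const)

text \<open>The mean value theorem is applied twice: in direction \<open>u\<close> to the increment
  of \<open>F\<close> by \<open>s *\<^sub>R v\<close>, then in direction \<open>v\<close> to
  \<open>dird F u\<close>. The second difference on the left is symmetric in \<open>u\<close> and
  \<open>v\<close>, which is what Schwarz's theorem exploits.\<close>

lemma second_difference_mean_value:
  fixes F :: "'a::euclidean_space \<Rightarrow> real"
  assumes sm: "smooth_on F S" and S: "\<And>a b. 0 \<le> a \<Longrightarrow> a \<le> s \<Longrightarrow> 0 \<le> b \<Longrightarrow> b \<le> s \<Longrightarrow> x + a *\<^sub>R u + b *\<^sub>R v \<in> S"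
    and s: "s > 0"
  shows "\<exists>a b. 0 \<le> a \<and> a \<le> s \<and> 0 \<le> b \<and> b \<le> s \<and>
    F (x + s *\<^sub>R u + s *\<^sub>R v) - F (x + s *\<^sub>R u) - F (x + s *\<^sub>R v) + F x
      = s * s * dird (dird F u) v (x + a *\<^sub>R u + b *\<^sub>R v)"
proof -
  define q where "q a = F (x + a *\<^sub>R u + s *\<^sub>R v) - F (x + a *\<^sub>R u)" for a
  have lin: "linear (frechet_derivative F (at y))" if "y \<in> S" for y
    using smooth_on_has_derivative[OF sm that] has_derivative_linear by blast
  have dF: "((\<lambda>a. F (x + a *\<^sub>R u + b *\<^sub>R v)) has_real_derivative dird F u (x + a *\<^sub>R u + b *\<^sub>R v)) (at a)"
    if "0 \<le> a" "a \<le> s" "0 \<le> b" "b \<le> s" for a b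
  proof -
    have "((\<lambda>a. x + a *\<^sub>R u + b *\<^sub>R v) has_derivative (\<lambda>h. h *\<^sub>R u)) (at a)"
      by (auto intro!: derivative_eq_intros)
    from has_derivative_compose[OF this smooth_on_has_derivative[OF sm S[OF that]]]
    show ?thesis
      unfolding has_field_derivative_def
      by (simp add: linear_scale[OF lin[OF S[OF that]]] mult_commute_abs)
  qed
  have "\<exists>z>0. z < s \<and> q s - q 0 = (s - 0) * (dird F u (x + z *\<^sub>R u + s *\<^sub>R v) - dird F u (x + z *\<^sub>R u))"
    apply (rule MVT2[OF s])
    unfolding q_def
    apply (rule DERIV_diff)
    using dF[of _ s] dF[of _ 0] s by auto
  then obtain a where a: "0 < a" "a < s"
    and qa: "q s - q 0 = s * (dird F u (x + a *\<^sub>R u + s *\<^sub>R v) - dird F u (x + a *\<^sub>R u))" by auto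
  define r where "r b = dird F u (x + a *\<^sub>R u + b *\<^sub>R v)" for b
  have lin2: "linear (frechet_derivative (dird F u) (at y))" if "y \<in> S" for y
    using smooth_on_has_derivative[OF smooth_on_dird[OF sm] that] has_derivative_linear by blast
  have "\<exists>z>0. z < s \<and> r s - r 0 = (s - 0) * dird (dird F u) v (x + a *\<^sub>R u + z *\<^sub>R v)"
  proof (rule MVT2[OF s])
    fix b assume b: "0 \<le> b" "b \<le> s"
    have xS: "x + a *\<^sub>R u + b *\<^sub>R v \<in> S" using S a b by auto
    have "((\<lambda>b. x + a *\<^sub>R u + b *\<^sub>R v) has_derivative (\<lambda>h. h *\<^sub>R v)) (at b)"
      by (auto intro!: derivative_eq_intros)
    from has_derivative_compose[OF this smooth_on_has_derivative[OF smooth_on_dird[OF sm, of u] xS]]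
    show "(r has_real_derivative dird (dird F u) v (x + a *\<^sub>R u + b *\<^sub>R v)) (at b)"
      unfolding has_field_derivative_def r_def
      by (simp add: linear_scale[OF lin2[OF xS]] mult_commute_abs)
  qed
  then obtain b where b: "0 < b" "b < s" "r s - r 0 = s * dird (dird F u) v (x + a *\<^sub>R u + b *\<^sub>R v)" by auto
  show ?thesis
    by (rule exI[of _ a], rule exI[of _ b]) (use a b qa in \<open>auto simp: q_def r_def\<close>)
qed

text \<open>The same second difference equals \<open>s * s\<close> times either mixed derivative at
  suitable points near \<open>x\<close>. If the two values at \<open>x\<close> differed, continuity
  would keep both mixed derivatives within half the gap of their values at \<open>x\<close>, so they
  could not agree at these points.\<close>

lemma smooth_on_symmetric_second_derivative_real:
  fixes F :: "'a::euclidean_space \<Rightarrow> real"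
  assumes sm: "smooth_on F S" and "open S" "x \<in> S"
  shows "dird (dird F u) v x = dird (dird F v) u x"
proof (rule ccontr)
  assume ne: "dird (dird F u) v x \<noteq> dird (dird F v) u x"
  define e where "e = \<bar>dird (dird F u) v x - dird (dird F v) u x\<bar> / 2"
  have e: "e > 0" using ne by (simp add: e_def)
  have ct: "\<exists>d>0. \<forall>y. dist y x < d \<longrightarrow> \<bar>dird (dird F u) v y - dird (dird F u) v x\<bar> < e" for u v
  proof -
    have "continuous_on S (dird (dird F u) v)"
      using sm smooth_on_dird smooth_on_continuous_on by blast
    then have "isCont (dird (dird F u) v) x"
      using assms by (simp add: continuous_on_eq_continuous_at)
    then show ?thesis unfolding continuous_at_eps_delta using e by (auto simp: dist_real_def)
  qed
  obtain d1 where d1: "d1 > 0" "\<And>y. dist y x < d1 \<Longrightarrow> \<bar>dird (dird F u) v y - dird (dird F u) v x\<bar> < e"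
    using ct[of u v] by blast
  obtain d2 where d2: "d2 > 0" "\<And>y. dist y x < d2 \<Longrightarrow> \<bar>dird (dird F v) u y - dird (dird F v) u x\<bar> < e"
    using ct[of v u] by blast
  obtain d3 where d3: "d3 > 0" "ball x d3 \<subseteq> S" using assms(2,3) openE by blast
  define d where "d = min d1 (min d2 d3)"
  \<comment> \<open>This size keeps the parallelogram spanned by \<open>s *\<^sub>R u\<close> and
    \<open>s *\<^sub>R v\<close> within \<open>d / 2\<close> of \<open>x\<close>; adding 1 covers
    the case that both vectors vanish.\<close>
  define s where "s = d / (2 * (norm u + norm v + 1))"
  have d: "d > 0" using d1 d2 d3 by (simp add: d_def)
  have n: "norm u + norm v + 1 > 0" by (smt (verit) norm_ge_zero)
  have s: "s > 0" using d n by (simp add: s_def)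
  \<comment> \<open>Stated for \<open>u'\<close> and \<open>v'\<close> with the same sum of norms,
    so that it applies to the vectors in either order.\<close>
  have near: "dist (x + a *\<^sub>R u' + b *\<^sub>R v') x < d"
    if "0 \<le> a" "a \<le> s" "0 \<le> b" "b \<le> s" "norm u' + norm v' = norm u + norm v" for a b u' v'
  proof -
    have "dist (x + a *\<^sub>R u' + b *\<^sub>R v') x = norm (a *\<^sub>R u' + b *\<^sub>R v')"
      by (simp add: dist_norm algebra_simps)
    also have "\<dots> \<le> a * norm u' + b * norm v'"
      using norm_triangle_ineq[of "a *\<^sub>R u'" "b *\<^sub>R v'"] that by simp
    also have "\<dots> \<le> s * norm u' + s * norm v'"
      using that by (intro add_mono mult_right_mono) auto
    also have "\<dots> = s * (norm u + norm v)" using that by (simp add: distrib_left[symmetric])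
    also have "\<dots> \<le> s * (norm u + norm v + 1)" using s by (intro mult_left_mono) auto
    also have "\<dots> = d / 2"
    proof -
      have "d / (2 * c) * c = d / 2" if "c > 0" for c :: real using that by simp
      from this[OF n] show ?thesis unfolding s_def .
    qed
    finally show ?thesis using d by simp
  qed
  have inS: "x + a *\<^sub>R u' + b *\<^sub>R v' \<in> S"
    if "0 \<le> a" "a \<le> s" "0 \<le> b" "b \<le> s" "norm u' + norm v' = norm u + norm v" for a b u' v'
    using near[OF that] d3(2) by (auto simp: d_def dist_commute)
  obtain a b where ab: "0 \<le> a" "a \<le> s" "0 \<le> b" "b \<le> s" and
    1: "F (x + s *\<^sub>R u + s *\<^sub>R v) - F (x + s *\<^sub>R u) - F (x + s *\<^sub>R v) + F x
      = s * s * dird (dird F u) v (x + a *\<^sub>R u + b *\<^sub>R v)"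
    using second_difference_mean_value[OF sm, of s x u v] inS s by blast
  obtain a' b' where ab': "0 \<le> a'" "a' \<le> s" "0 \<le> b'" "b' \<le> s" and
    2: "F (x + s *\<^sub>R v + s *\<^sub>R u) - F (x + s *\<^sub>R v) - F (x + s *\<^sub>R u) + F x
      = s * s * dird (dird F v) u (x + a' *\<^sub>R v + b' *\<^sub>R u)"
    using second_difference_mean_value[OF sm, of s x v u] inS[of _ _ v u] s by (auto simp: add.commute)
  have "s * s * dird (dird F u) v (x + a *\<^sub>R u + b *\<^sub>R v) = s * s * dird (dird F v) u (x + a' *\<^sub>R v + b' *\<^sub>R u)"
    using 1 2 by (simp add: algebra_simps)
  then have "dird (dird F u) v (x + a *\<^sub>R u + b *\<^sub>R v) = dird (dird F v) u (x + a' *\<^sub>R v + b' *\<^sub>R u)"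
    using s by simp
  moreover have "\<bar>dird (dird F u) v (x + a *\<^sub>R u + b *\<^sub>R v) - dird (dird F u) v x\<bar> < e"
    using d1(2) near[OF ab] by (simp add: d_def)
  moreover have "\<bar>dird (dird F v) u (x + a' *\<^sub>R v + b' *\<^sub>R u) - dird (dird F v) u x\<bar> < e"
    using d2(2) near[OF ab', of v u] by (simp add: d_def)
  ultimately show False unfolding e_def by (simp add: abs_if split: if_splits)
qed

lemma dird_inner_left:
  assumes "f differentiable (at x)"
  shows "dird (\<lambda>x. f x \<bullet> b) v x = dird f v x \<bullet> b"
proof -
  have "(f has_derivative frechet_derivative f (at x)) (at x)"
    using assms frechet_derivative_works by blast
  then have "((\<lambda>x. f x \<bullet> b) has_derivative (\<lambda>v. dird f v x \<bullet> b)) (at x)"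
    by (rule has_derivative_inner_left)
  then show ?thesis by (metis frechet_derivative_at)
qed

lemma smooth_on_symmetric_second_derivative:
  fixes F :: "'a::euclidean_space \<Rightarrow> 'b::euclidean_space"
  assumes sm: "smooth_on F S" and "open S" "x \<in> S"
  shows "dird (dird F u) v x = dird (dird F v) u x"
proof (rule euclidean_eqI)
  fix b :: 'b assume "b \<in> Basis"
  have diff: "F differentiable (at y)" if "y \<in> S" for y
    using smooth_on_has_derivative[OF sm that] by (auto simp: differentiable_def)
  have *: "dird (dird F u) v x \<bullet> b = dird (dird (\<lambda>x. F x \<bullet> b) u) v x" for u v
  proof -
    have "dird (dird F u) v x \<bullet> b = dird (\<lambda>y. dird F u y \<bullet> b) v x"
      using smooth_on_has_derivative[OF smooth_on_dird[OF sm] \<open>x \<in> S\<close>]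
      by (subst dird_inner_left) (auto simp: differentiable_def)
    also have "\<dots> = dird (dird (\<lambda>x. F x \<bullet> b) u) v x"
      using frechet_derivative_cong_open[OF assms(2,3), of "\<lambda>y. dird F u y \<bullet> b" "dird (\<lambda>x. F x \<bullet> b) u"]
        dird_inner_left[OF diff] by metis
    finally show ?thesis .
  qed
  show "dird (dird F u) v x \<bullet> b = dird (dird F v) u x \<bullet> b"
    unfolding * using smooth_on_symmetric_second_derivative_real[OF smooth_on_inner_left[OF assms(2) sm] assms(2,3)] .
qed

section \<open>Riemannian forms on open sets\<close>

definition riemannian_form :: "'e::euclidean_space set \<Rightarrow> ('e \<Rightarrow> 'e \<Rightarrow> 'e \<Rightarrow> real) \<Rightarrow> bool" where
  "riemannian_form S h \<longleftrightarrow>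
     (\<forall>x\<in>S. bilinear (h x) \<and> (\<forall>u v. h x u v = h x v u) \<and> (\<forall>u. u \<noteq> 0 \<longrightarrow> h x u u > 0)) \<and>
     (\<forall>u v. smooth_on (\<lambda>x. h x u v) S)"

definition preserves_forms ::
  "('e::euclidean_space \<Rightarrow> 'e \<Rightarrow> 'e \<Rightarrow> real) \<Rightarrow> ('e \<Rightarrow> 'e \<Rightarrow> 'e \<Rightarrow> real) \<Rightarrow> ('e \<Rightarrow> 'e) \<Rightarrow> 'e set \<Rightarrow> bool" where
  "preserves_forms g h f S \<longleftrightarrow> (\<forall>x\<in>S. \<forall>u v. h (f x) (dird f u x) (dird f v x) = g x u v)"

lemma linear_Basis_expansion:
  fixes f :: "'e::euclidean_space \<Rightarrow> 'b::real_vector"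
  assumes "linear f"
  shows "f u = (\<Sum>b\<in>Basis. (u \<bullet> b) *\<^sub>R f b)"
  by (subst euclidean_representation[of u, symmetric])
    (simp only: linear_sum[OF assms] linear_scale[OF assms])

lemma bilinear_Basis_expansion:
  fixes h :: "'e::euclidean_space \<Rightarrow> 'e \<Rightarrow> real"
  assumes "bilinear h"
  shows "h u v = (\<Sum>a\<in>Basis. \<Sum>b\<in>Basis. (u \<bullet> a) * (v \<bullet> b) * h a b)"
proof -
  have "linear (\<lambda>u. h u v)" for v using assms by (simp add: bilinear_def)
  from linear_Basis_expansion[OF this[of v], of u]
  have "h u v = (\<Sum>a\<in>Basis. (u \<bullet> a) * h a v)" by simp
  moreover have "h a v = (\<Sum>b\<in>Basis. (v \<bullet> b) * h a b)" for a
    using linear_Basis_expansion[of "h a" v] assms by (simp add: bilinear_def)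
  ultimately show ?thesis by (simp add: sum_distrib_left mult.assoc)
qed

lemma riemannian_form_subset:
  "riemannian_form S h \<Longrightarrow> T \<subseteq> S \<Longrightarrow> riemannian_form T h"
  unfolding riemannian_form_def using smooth_on_subset by blast

context
  fixes S :: "'e::euclidean_space set" and h :: "'e \<Rightarrow> 'e \<Rightarrow> 'e \<Rightarrow> real"
  assumes h: "riemannian_form S h"
begin

lemma riemannian_form_bilinear: "x \<in> S \<Longrightarrow> bilinear (h x)"
  and riemannian_form_sym: "x \<in> S \<Longrightarrow> h x u v = h x v u"
  and riemannian_form_pos: "x \<in> S \<Longrightarrow> u \<noteq> 0 \<Longrightarrow> h x u u > 0"
  and riemannian_form_smooth: "smooth_on (\<lambda>x. h x u v) S"
  using h unfolding riemannian_form_def by blast+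

text \<open>Smoothness is given only for fixed \<open>u\<close> and \<open>v\<close>; the basis
  expansion of a bilinear form turns it into joint continuity.\<close>

lemma riemannian_form_continuous_on:
  "continuous_on (S \<times> UNIV \<times> UNIV) (\<lambda>(x, u, v). h x u v)"
proof -
  have "continuous_on (S \<times> UNIV \<times> UNIV)
      (\<lambda>p. \<Sum>a\<in>Basis. \<Sum>b\<in>Basis. (fst (snd p) \<bullet> a) * (snd (snd p) \<bullet> b) * h (fst p) a b)"
    by (intro continuous_intros continuous_on_compose2[OF smooth_on_continuous_on[OF riemannian_form_smooth]])
      (auto)
  then show ?thesis
    by (rule continuous_on_eq) (use bilinear_Basis_expansion[OF riemannian_form_bilinear] in auto)
qed

lemma riemannian_form_scale: "x \<in> S \<Longrightarrow> h x (c *\<^sub>R u) (c *\<^sub>R u) = c\<^sup>2 * h x u u"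
  using bilinear_lmul[OF riemannian_form_bilinear] bilinear_rmul[OF riemannian_form_bilinear]
  by (simp add: power2_eq_square)

text \<open>\<open>m\<close> and \<open>M\<close> are the extreme values of the quadratic form on
  the compact product of \<open>K\<close> with the unit sphere; homogeneity carries the bounds to
  all vectors.\<close>

lemma riemannian_form_bounds:
  assumes "compact K" "K \<subseteq> S"
  obtains m M where "m > 0" "M > 0"
    "\<And>x u. x \<in> K \<Longrightarrow> m * (norm u)\<^sup>2 \<le> h x u u" "\<And>x u. x \<in> K \<Longrightarrow> h x u u \<le> M * (norm u)\<^sup>2"
proof (cases "K = {}")
  case True
  then show ?thesis using that[of 1 1] by auto
next
  case False
  define Q where "Q = K \<times> sphere (0::'e) 1"
  have cQ: "compact Q" unfolding Q_def using assms by (intro compact_Times) auto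
  obtain b :: 'e where "b \<in> Basis" using nonempty_Basis by blast
  then have ne: "Q \<noteq> {}" using False by (auto simp: Q_def intro!: exI[of _ b])
  have ct: "continuous_on Q (\<lambda>p. h (fst p) (snd p) (snd p))"
    using continuous_on_compose2[OF riemannian_form_continuous_on, of Q "\<lambda>p. (fst p, snd p, snd p)"] assms
    by (force simp: Q_def intro!: continuous_intros)
  obtain p where p: "p \<in> Q" "\<And>q. q \<in> Q \<Longrightarrow> h (fst p) (snd p) (snd p) \<le> h (fst q) (snd q) (snd q)"
    using continuous_attains_inf[OF cQ ne ct] by blast
  obtain p' where p': "p' \<in> Q" "\<And>q. q \<in> Q \<Longrightarrow> h (fst q) (snd q) (snd q) \<le> h (fst p') (snd p') (snd p')"
    using continuous_attains_sup[OF cQ ne ct] by blast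
  have pos: "h (fst q) (snd q) (snd q) > 0" if "q \<in> Q" for q
  proof (rule riemannian_form_pos)
    show "fst q \<in> S" "snd q \<noteq> 0" using that assms by (auto simp: Q_def)
  qed
  have unit: "h x u u = (norm u)\<^sup>2 * h x (sgn u) (sgn u)" "(x, sgn u) \<in> Q" if "x \<in> K" "u \<noteq> 0" for x u
  proof -
    have "u = norm u *\<^sub>R sgn u" using that by (simp add: sgn_div_norm)
    then show "h x u u = (norm u)\<^sup>2 * h x (sgn u) (sgn u)"
      using riemannian_form_scale[of x "norm u" "sgn u"] that assms by auto
    show "(x, sgn u) \<in> Q" using that by (simp add: Q_def norm_sgn)
  qed
  have zero: "h x 0 0 = 0" if "x \<in> K" for x
    using riemannian_form_scale[of x 0 0] that assms by auto
  show ?thesis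
  proof (rule that[OF pos[OF p(1)] pos[OF p'(1)]])
    fix x u assume x: "x \<in> K"
    show "h (fst p) (snd p) (snd p) * (norm u)\<^sup>2 \<le> h x u u"
      using unit[OF x, of u] p(2)[of "(x, sgn u)"] zero[OF x]
      by (cases "u = 0") (auto simp: mult.commute intro!: mult_left_mono)
    show "h x u u \<le> h (fst p') (snd p') (snd p') * (norm u)\<^sup>2"
      using unit[OF x, of u] p'(2)[of "(x, sgn u)"] zero[OF x]
      by (cases "u = 0") (auto simp: mult.commute intro!: mult_left_mono)
  qed
qed

text \<open>Raises an index; outside \<open>S\<close> the value is arbitrary.\<close>
definition sharp :: "'e \<Rightarrow> 'e \<Rightarrow> 'e" where
  "sharp x w = (SOME z. \<forall>v. h x z v = w \<bullet> v)"

lemma riemannian_form_eqI: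
  assumes "x \<in> S" "\<And>v. h x z v = h x z' v"
  shows "z = z'"
proof (rule ccontr)
  assume "z \<noteq> z'"
  then have "h x (z - z') (z - z') > 0" using riemannian_form_pos assms by simp
  then show False using bilinear_lsub[OF riemannian_form_bilinear[OF assms(1)]] assms(2) by simp
qed

text \<open>The linear map \<open>A\<close> represents the form through the Euclidean inner product.
  Positivity makes it injective, hence surjective in finite dimension, so the vector chosen in
  \<open>sharp\<close> exists.\<close>

lemma sharp:
  assumes x: "x \<in> S"
  shows "h x (sharp x w) v = w \<bullet> v"
proof -
  define A where "A z = (\<Sum>b\<in>Basis. h x z b *\<^sub>R b)" for z
  have lin1: "linear (\<lambda>z. h x z v)" for v using riemannian_form_bilinear[OF x] by (simp add: bilinear_def)
  have lin2: "linear (h x z)" for z using riemannian_form_bilinear[OF x] by (simp add: bilinear_def)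
  have "linear A" unfolding A_def
    by (intro linear_compose_sum ballI) (auto intro!: linearI simp: linear_add[OF lin1] linear_scale[OF lin1] algebra_simps)
  have Ab: "A z \<bullet> v = h x z v" for z v
  proof -
    have "A z \<bullet> v = (\<Sum>b\<in>Basis. (v \<bullet> b) * h x z b)"
      unfolding A_def by (simp add: inner_sum_left mult.commute inner_commute[of v])
    then show ?thesis using linear_Basis_expansion[OF lin2[of z], of v] by simp
  qed
  have "inj A"
  proof (rule injI)
    fix z z' assume "A z = A z'"
    then have "h x z v = h x z' v" for v using Ab by metis
    then show "z = z'" using riemannian_form_eqI[OF x] by blast
  qed
  then have "surj A" using linear_injective_imp_surjective[OF \<open>linear A\<close>] by blast
  then obtain z where "A z = w" by (metis surjD)
  then have "\<forall>v. h x z v = w \<bullet> v" by (simp flip: Ab)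
  from someI[of "\<lambda>z. \<forall>v. h x z v = w \<bullet> v", OF this] show ?thesis
    unfolding sharp_def by blast
qed

lemma sharp_eqI:
  assumes x: "x \<in> S" and "\<And>v. h x z v = w \<bullet> v"
  shows "sharp x w = z"
  by (rule riemannian_form_eqI[OF x]) (simp only: sharp[OF x] assms(2))

text \<open>The resolvent identity \<open>B\<^sup>-\<^sup>1 - A\<^sup>-\<^sup>1 = - B\<^sup>-\<^sup>1 (B - A) A\<^sup>-\<^sup>1\<close>.\<close>
lemma sharp_diff:
  assumes x: "x \<in> S" and y: "y \<in> S"
  shows "sharp y w = sharp x w - (\<Sum>b\<in>Basis. (h y (sharp x w) b - h x (sharp x w) b) *\<^sub>R sharp y b)"
proof (rule sharp_eqI[OF y])
  fix v
  have lin1: "linear (\<lambda>z. h y z v)" for v using riemannian_form_bilinear[OF y] by (simp add: bilinear_def)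
  have lin2: "linear (\<lambda>v. h y (sharp x w) v - h x (sharp x w) v)"
    using riemannian_form_bilinear[OF y] riemannian_form_bilinear[OF x]
    by (intro linear_compose_sub) (auto simp: bilinear_def)
  have "h y (sharp x w - (\<Sum>b\<in>Basis. (h y (sharp x w) b - h x (sharp x w) b) *\<^sub>R sharp y b)) v =
     h y (sharp x w) v - (\<Sum>b\<in>Basis. (h y (sharp x w) b - h x (sharp x w) b) * h y (sharp y b) v)"
    by (simp add: linear_diff[OF lin1] linear_sum[OF lin1] linear_scale[OF lin1])
  also have "(\<Sum>b\<in>Basis. (h y (sharp x w) b - h x (sharp x w) b) * h y (sharp y b) v)
     = (\<Sum>b\<in>Basis. (v \<bullet> b) *\<^sub>R (h y (sharp x w) b - h x (sharp x w) b))"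
    by (simp add: sharp[OF y] mult.commute inner_commute)
  also have "\<dots> = h y (sharp x w) v - h x (sharp x w) v"
    using linear_Basis_expansion[OF lin2, of v] by simp
  finally show "h y (sharp x w - (\<Sum>b\<in>Basis. (h y (sharp x w) b - h x (sharp x w) b) *\<^sub>R sharp y b)) v = w \<bullet> v"
    by (simp add: sharp[OF x])
qed

lemma isCont_sharp:
  assumes "open S" and x: "x \<in> S"
  shows "isCont (\<lambda>y. sharp y w) x"
proof -
  obtain r where r: "r > 0" "cball x r \<subseteq> S" using assms open_contains_cball by blast
  obtain m where m: "m > 0" "\<And>y u. y \<in> cball x r \<Longrightarrow> m * (norm u)\<^sup>2 \<le> h y u u"
    using riemannian_form_bounds[OF compact_cball r(2)] by metis
  \<comment> \<open>Coercivity: with \<open>z = sharp y w\<close>, \<open>m\<close> times the square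
    of the norm of \<open>z\<close> is at most \<open>h y z z\<close>, which equals
    \<open>w \<bullet> z\<close>. The bound is uniform in \<open>y\<close> and makes every term of
    the resolvent identity small.\<close>
  have bd: "norm (sharp y w) \<le> norm w / m" if y: "y \<in> cball x r" for y w
  proof (cases "sharp y w = 0")
    case False
    have "m * (norm (sharp y w))\<^sup>2 \<le> w \<bullet> sharp y w"
      using m(2)[OF y, of "sharp y w"] sharp[of y w "sharp y w"] r(2) y by auto
    also have "\<dots> \<le> norm w * norm (sharp y w)" by (rule norm_cauchy_schwarz)
    finally show ?thesis using m(1) False by (simp add: power2_eq_square field_simps)
  qed (use m in auto)
  let ?z = "sharp x w"
  have "isCont (\<lambda>y. h y ?z b) x" for b
    using smooth_on_continuous_on[OF riemannian_form_smooth] assms continuous_on_eq_continuous_at by blast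
  then have "isCont (\<lambda>y. \<Sum>b\<in>Basis. \<bar>h y ?z b - h x ?z b\<bar> * (norm b / m)) x"
    by (intro continuous_intros) auto
  then have 1: "((\<lambda>y. \<Sum>b\<in>Basis. \<bar>h y ?z b - h x ?z b\<bar> * (norm b / m)) \<longlongrightarrow> 0) (at x)"
    unfolding isCont_def by simp
  have "norm (sharp y w - ?z) \<le> (\<Sum>b\<in>Basis. \<bar>h y ?z b - h x ?z b\<bar> * (norm b / m))" if y: "y \<in> cball x r" for y
  proof -
    have "sharp y w - ?z = - (\<Sum>b\<in>Basis. (h y ?z b - h x ?z b) *\<^sub>R sharp y b)"
      using sharp_diff[OF x, of y w] y r(2) by auto
    then have "norm (sharp y w - ?z) \<le> (\<Sum>b\<in>Basis. norm ((h y ?z b - h x ?z b) *\<^sub>R sharp y b))"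
      by (simp only: norm_minus_cancel norm_sum)
    also have "\<dots> \<le> (\<Sum>b\<in>Basis. \<bar>h y ?z b - h x ?z b\<bar> * (norm b / m))"
      by (intro sum_mono) (simp only: norm_scaleR, intro mult_left_mono bd y, auto)
    finally show ?thesis .
  qed
  then have "\<forall>\<^sub>F y in at x. norm (sharp y w - ?z) \<le> (\<Sum>b\<in>Basis. \<bar>h y ?z b - h x ?z b\<bar> * (norm b / m))"
    using r(1) by (auto simp: eventually_at intro!: exI[of _ r] simp: dist_commute)
  from Lim_null_comparison[OF this 1] show ?thesis
    unfolding isCont_def by (simp add: LIM_zero_iff)
qed

end

text \<open>A product rule in which the second factor is only continuous: as \<open>q\<close>
  vanishes at \<open>x\<close>, replacing \<open>r y\<close> by \<open>r x\<close> costs an error of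
  lower order. It serves to differentiate the resolvent identity, in which \<open>sharp\<close>
  itself occurs as the second factor.\<close>

lemma has_derivative_scaleR_vanishing:
  fixes q :: "'a::real_normed_vector \<Rightarrow> real" and r :: "'a \<Rightarrow> 'b::real_normed_vector"
  assumes q: "(q has_derivative q') (at x)" "q x = 0" and r: "isCont r x"
  shows "((\<lambda>y. q y *\<^sub>R r y) has_derivative (\<lambda>v. q' v *\<^sub>R r x)) (at x)"
proof -
  obtain K where K: "K > 0" "\<And>v. norm (q' v) \<le> norm v * K"
    using bounded_linear.pos_bounded[OF has_derivative_bounded_linear[OF q(1)]] by blast
  have "((\<lambda>y. q y *\<^sub>R (r y - r x)) has_derivative (\<lambda>v. 0)) (at x)"
    unfolding has_derivative_at_alt
  proof (intro conjI allI impI)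
    fix e :: real assume e: "e > 0"
    obtain d1 where d1: "d1 > 0" "\<And>y. norm (y - x) < d1 \<Longrightarrow> norm (q y - q x - q' (y - x)) \<le> 1 * norm (y - x)"
      using q(1) unfolding has_derivative_at_alt by (metis zero_less_one)
    \<comment> \<open>Near \<open>x\<close>, the norm of \<open>q y\<close> is at most
      \<open>K + 1\<close> times the distance to \<open>x\<close>: \<open>K\<close> bounds the
      linear part and 1 the remainder.\<close>
    have "e / (K + 1) > 0" using e K by simp
    then obtain d2 where d2: "d2 > 0" "\<And>y. dist y x < d2 \<Longrightarrow> dist (r y) (r x) < e / (K + 1)"
      using r unfolding continuous_at_eps_delta by blast
    show "\<exists>d>0. \<forall>y. norm (y - x) < d \<longrightarrow>
       norm (q y *\<^sub>R (r y - r x) - q x *\<^sub>R (r x - r x) - 0) \<le> e * norm (y - x)"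
    proof (intro exI[of _ "min d1 d2"] conjI allI impI)
      fix y assume y: "norm (y - x) < min d1 d2"
      have "norm (q y) \<le> norm (q' (y - x)) + norm (q y - q' (y - x))"
        using norm_triangle_sub by blast
      also have "\<dots> \<le> norm (y - x) * K + norm (y - x)"
        using d1(2)[of y] K(2)[of "y - x"] y q(2) by auto
      finally have "norm (q y) \<le> (K + 1) * norm (y - x)" by (simp add: algebra_simps)
      moreover have "norm (r y - r x) \<le> e / (K + 1)" using d2(2)[of y] y by (simp add: dist_norm)
      ultimately have "norm (q y) * norm (r y - r x) \<le> ((K + 1) * norm (y - x)) * (e / (K + 1))"
        using K by (intro mult_mono) auto
      then show "norm (q y *\<^sub>R (r y - r x) - q x *\<^sub>R (r x - r x) - 0) \<le> e * norm (y - x)"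
        using K by (simp add: mult.commute[of e])
    qed (use d1 d2 in auto)
  qed (auto intro: bounded_linear_zero)
  moreover have "((\<lambda>y. q y *\<^sub>R r x) has_derivative (\<lambda>v. q' v *\<^sub>R r x)) (at x)"
    using q(1) by (auto intro!: derivative_eq_intros)
  ultimately have "((\<lambda>y. q y *\<^sub>R r x + q y *\<^sub>R (r y - r x)) has_derivative (\<lambda>v. q' v *\<^sub>R r x + 0)) (at x)"
    by (intro has_derivative_add)
  then show ?thesis by (simp add: scaleR_diff_right)
qed

text \<open>This is the formula \<open>- B\<^sup>-\<^sup>1 (DB) B\<^sup>-\<^sup>1\<close> for the
  derivative of an inverse. In the resolvent identity based at \<open>x\<close>, each scalar
  coefficient vanishes at \<open>x\<close>, so the preceding product rule applies.\<close>

lemma has_derivative_sharp: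
  assumes h: "riemannian_form S h" and "open S" and x: "x \<in> S"
  shows "((\<lambda>y. sharp h y w) has_derivative
    (\<lambda>v. - (\<Sum>b\<in>Basis. (\<Sum>a\<in>Basis. (sharp h x w \<bullet> a) * dird (\<lambda>y. h y a b) v x) *\<^sub>R sharp h x b))) (at x)"
proof -
  let ?z = "sharp h x w"
  have exp: "h y ?z b = (\<Sum>a\<in>Basis. (?z \<bullet> a) * h y a b)" if "y \<in> S" for y b
    using linear_Basis_expansion[of "\<lambda>z. h y z b" ?z] riemannian_form_bilinear[OF h that]
    by (simp add: bilinear_def)
  have "((\<lambda>y. \<Sum>a\<in>Basis. (?z \<bullet> a) * h y a b) has_derivative
     (\<lambda>v. \<Sum>a\<in>Basis. (?z \<bullet> a) * dird (\<lambda>y. h y a b) v x)) (at x)" for b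
    by (intro has_derivative_sum has_derivative_mult_right
        smooth_on_has_derivative[OF riemannian_form_smooth[OF h] x])
  then have dz: "((\<lambda>y. h y ?z b) has_derivative
     (\<lambda>v. \<Sum>a\<in>Basis. (?z \<bullet> a) * dird (\<lambda>y. h y a b) v x)) (at x)" for b
    by (rule has_derivative_transform_open[OF _ \<open>open S\<close> x]) (rule exp)
  have "((\<lambda>y. (h y ?z b - h x ?z b) *\<^sub>R sharp h y b) has_derivative
     (\<lambda>v. (\<Sum>a\<in>Basis. (?z \<bullet> a) * dird (\<lambda>y. h y a b) v x) *\<^sub>R sharp h x b)) (at x)" for b
  proof (rule has_derivative_scaleR_vanishing)
    show "((\<lambda>y. h y ?z b - h x ?z b) has_derivative
     (\<lambda>v. \<Sum>a\<in>Basis. (?z \<bullet> a) * dird (\<lambda>y. h y a b) v x)) (at x)"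
      using has_derivative_diff[OF dz has_derivative_const] by simp
  qed (use isCont_sharp[OF h \<open>open S\<close> x] in auto)
  then have "((\<lambda>y. ?z - (\<Sum>b\<in>Basis. (h y ?z b - h x ?z b) *\<^sub>R sharp h y b)) has_derivative
     (\<lambda>v. 0 - (\<Sum>b\<in>Basis. (\<Sum>a\<in>Basis. (?z \<bullet> a) * dird (\<lambda>y. h y a b) v x) *\<^sub>R sharp h x b))) (at x)"
    by (intro has_derivative_diff has_derivative_const has_derivative_sum)
  then have "((\<lambda>y. sharp h y w) has_derivative
     (\<lambda>v. 0 - (\<Sum>b\<in>Basis. (\<Sum>a\<in>Basis. (?z \<bullet> a) * dird (\<lambda>y. h y a b) v x) *\<^sub>R sharp h x b))) (at x)"
    by (rule has_derivative_transform_open[OF _ \<open>open S\<close> x]) (rule sharp_diff[OF h x])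
  then show ?thesis by simp
qed

text \<open>The derivative is polynomial in \<open>sharp\<close> itself and in first derivatives of
  the coefficients of \<open>h\<close>, so each order of regularity yields the next one.\<close>

lemma smooth_on_sharp:
  assumes h: "riemannian_form S h" and S: "open S"
  shows "smooth_on (\<lambda>y. sharp h y w) S"
proof -
  have "times_differentiable_on k (\<lambda>y. sharp h y w) S" for k w
  proof (induction k arbitrary: w)
    case 0
    then show ?case using isCont_sharp[OF h S] by (simp add: continuous_at_imp_continuous_on)
  next
    case (Suc k)
    show ?case
    proof (rule times_differentiable_on_SucI[OF S has_derivative_sharp[OF h S]])
      fix v
      have "times_differentiable_on k (\<lambda>x. 0 - (\<Sum>b\<in>Basis. (\<Sum>a\<in>Basis. (sharp h x w \<bullet> a) * dird (\<lambda>y. h y a b) v x) *\<^sub>R sharp h x b)) S"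
        using smooth_on_dird[OF riemannian_form_smooth[OF h]] unfolding smooth_on_def
        by (intro times_differentiable_on_diff times_differentiable_on_sum times_differentiable_on_scaleR
            times_differentiable_on_mult times_differentiable_on_inner
            times_differentiable_on_const S Suc) auto
      then show "times_differentiable_on k (\<lambda>x. - (\<Sum>b\<in>Basis. (\<Sum>a\<in>Basis. (sharp h x w \<bullet> a) * dird (\<lambda>y. h y a b) v x) *\<^sub>R sharp h x b)) S"
        by simp
    qed
  qed
  then show ?thesis by (simp add: smooth_on_def)
qed

section \<open>The Hessian of a local isometry\<close>

text \<open>
  For an isometry \<open>f\<close>, with \<open>P = Df\<close> and \<open>y = f x\<close>, this is the part of the derivative of
  \<open>h (f x) (Df u) (Df v) = g x u v\<close> in direction \<open>w\<close> that does not involve second derivatives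
  of \<open>f\<close>.
\<close>
definition first_order_part ::
  "('e::euclidean_space \<Rightarrow> 'e \<Rightarrow> 'e \<Rightarrow> real) \<Rightarrow> ('e \<Rightarrow> 'e \<Rightarrow> 'e \<Rightarrow> real) \<Rightarrow> 'e \<Rightarrow> 'e \<Rightarrow> 'e \<Rightarrow> 'e \<Rightarrow> 'e \<Rightarrow> ('e \<Rightarrow> 'e) \<Rightarrow> real" where
  "first_order_part g h w u v x y P = dird (\<lambda>x. g x u v) w x -
     (\<Sum>a\<in>Basis. \<Sum>b\<in>Basis. \<Sum>c\<in>Basis. (P w \<bullet> c) * dird (\<lambda>y. h y a b) c y * ((P u \<bullet> a) * (P v \<bullet> b)))"

text \<open>The half-sum is Koszul's expression for the product of the Hessian
  \<open>D\<^sup>2f(u, w)\<close> with \<open>P k\<close>. Raising the index \<open>k\<close> by the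
  source metric \<open>g\<close> gives a tangent vector at \<open>x\<close>, and \<open>P\<close>
  maps it to the Hessian because \<open>P\<close> is isometric. The inner sum is
  \<open>P (sharp g x k)\<close>, expanded so that only the values of \<open>P\<close> on the basis
  enter.\<close>

definition hessian_rhs ::
  "('e::euclidean_space \<Rightarrow> 'e \<Rightarrow> 'e \<Rightarrow> real) \<Rightarrow> ('e \<Rightarrow> 'e \<Rightarrow> 'e \<Rightarrow> real) \<Rightarrow> 'e \<Rightarrow> 'e \<Rightarrow> 'e \<Rightarrow> 'e \<Rightarrow> ('e \<Rightarrow> 'e) \<Rightarrow> 'e" where
  "hessian_rhs g h u w x y P = (\<Sum>k\<in>Basis.
     ((first_order_part g h u w k x y P + first_order_part g h w u k x y P - first_order_part g h k u w x y P) / 2) *\<^sub>R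
       (\<Sum>l\<in>Basis. (sharp g x k \<bullet> l) *\<^sub>R P l))"

text \<open>After expanding \<open>h\<close> in the basis, the isometry equation involves only
  products of real functions. The product rule gives the two terms with second derivatives of
  \<open>f\<close>, and the chain rule the term that \<open>first_order_part\<close>
  subtracts.\<close>

lemma derivative_of_preserved_form:
  assumes S: "open S" and V: "open V" and g: "riemannian_form S g" and h: "riemannian_form V h"
    and f: "smooth_on f S" "f ` S \<subseteq> V" "preserves_forms g h f S" and x: "x \<in> S"
  shows "first_order_part g h w u v x (f x) (\<lambda>w. dird f w x) =
     h (f x) (dird (dird f u) w x) (dird f v x) + h (f x) (dird f u x) (dird (dird f v) w x)"
proof -
  have fx: "f x \<in> V" using f x by auto
  note bl = riemannian_form_bilinear[OF h fx]
  note Df = smooth_on_has_derivative[OF f(1) x]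
  have dh: "((\<lambda>x. h (f x) a b) has_derivative (\<lambda>w. \<Sum>c\<in>Basis. (dird f w x \<bullet> c) * dird (\<lambda>y. h y a b) c (f x))) (at x)" for a b
  proof -
    note Dh = smooth_on_has_derivative[OF riemannian_form_smooth[OF h, of a b] fx]
    have "((\<lambda>x. h (f x) a b) has_derivative (\<lambda>w. dird (\<lambda>y. h y a b) (dird f w x) (f x))) (at x)"
      using has_derivative_compose[OF Df Dh] .
    moreover have "dird (\<lambda>y. h y a b) (dird f w x) (f x) =
        (\<Sum>c\<in>Basis. (dird f w x \<bullet> c) * dird (\<lambda>y. h y a b) c (f x))" for w
      using linear_Basis_expansion[OF has_derivative_linear[OF Dh], of "dird f w x"] by simp
    ultimately show ?thesis by simp
  qed
  have df: "((\<lambda>x. dird f u x \<bullet> a) has_derivative (\<lambda>w. dird (dird f u) w x \<bullet> a)) (at x)" for u a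
    by (intro has_derivative_inner_left smooth_on_has_derivative[OF smooth_on_dird[OF f(1)] x])
  have dF: "((\<lambda>x. \<Sum>a\<in>Basis. \<Sum>b\<in>Basis. ((dird f u x \<bullet> a) * (dird f v x \<bullet> b)) * h (f x) a b) has_derivative
    (\<lambda>w. \<Sum>a\<in>Basis. \<Sum>b\<in>Basis.
       ((dird f u x \<bullet> a) * (dird f v x \<bullet> b)) * (\<Sum>c\<in>Basis. (dird f w x \<bullet> c) * dird (\<lambda>y. h y a b) c (f x)) +
       ((dird f u x \<bullet> a) * (dird (dird f v) w x \<bullet> b) + (dird (dird f u) w x \<bullet> a) * (dird f v x \<bullet> b)) * h (f x) a b)) (at x)"
    (is "(?F has_derivative ?F') _")
    by (intro has_derivative_sum has_derivative_mult df dh)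
  have Fg: "g y u v = ?F y" if "y \<in> S" for y
  proof -
    have "f y \<in> V" using f that by auto
    then have "?F y = h (f y) (dird f u y) (dird f v y)"
      by (subst bilinear_Basis_expansion[OF riemannian_form_bilinear[OF h]]) auto
    then show ?thesis using f(3) that by (simp add: preserves_forms_def)
  qed
  have "((\<lambda>y. g y u v) has_derivative ?F') (at x)"
    by (rule has_derivative_transform_open[OF dF S x]) (rule Fg)
  from fun_cong[OF frechet_derivative_at[OF this], of w]
  have "dird (\<lambda>x. g x u v) w x = ?F' w" by (rule sym)
  also have "\<dots> = (\<Sum>a\<in>Basis. \<Sum>b\<in>Basis. \<Sum>c\<in>Basis. (dird f w x \<bullet> c) * dird (\<lambda>y. h y a b) c (f x) * ((dird f u x \<bullet> a) * (dird f v x \<bullet> b)))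
    + (\<Sum>a\<in>Basis. \<Sum>b\<in>Basis. (dird (dird f u) w x \<bullet> a) * (dird f v x \<bullet> b) * h (f x) a b)
    + (\<Sum>a\<in>Basis. \<Sum>b\<in>Basis. (dird f u x \<bullet> a) * (dird (dird f v) w x \<bullet> b) * h (f x) a b)"
    by (simp add: sum.distrib distrib_right distrib_left sum_distrib_left mult_ac)
  finally show ?thesis
    unfolding first_order_part_def bilinear_Basis_expansion[OF bl, of "dird (dird f u) w x"]
      bilinear_Basis_expansion[OF bl, of "dird f u x"]
    by simp
qed

text \<open>
  Koszul's argument: since second derivatives are symmetric, the three cyclic versions of the
  derivative of the isometry equation determine them.
\<close>
lemma second_derivative_of_isometry:
  assumes S: "open S" and V: "open V" and g: "riemannian_form S g" and h: "riemannian_form V h"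
    and f: "smooth_on f S" "f ` S \<subseteq> V" "preserves_forms g h f S" and x: "x \<in> S"
  shows "dird (dird f u) w x = hessian_rhs g h u w x (f x) (\<lambda>w. dird f w x)"
proof -
  have fx: "f x \<in> V" using f x by auto
  note bl = riemannian_form_bilinear[OF h fx]
  note sy = riemannian_form_sym[OF h fx]
  note kos = derivative_of_preserved_form[OF S V g h f x]
  note sym = smooth_on_symmetric_second_derivative[OF f(1) S x]
  let ?P = "\<lambda>w. dird f w x"
  have linP: "linear ?P" using has_derivative_linear[OF smooth_on_has_derivative[OF f(1) x]] .
  have iso: "h (f x) (?P a) (?P b) = g x a b" for a b
    using f(3) x by (simp add: preserves_forms_def)
  define T where "T k = (first_order_part g h u w k x (f x) ?P + first_order_part g h w u k x (f x) ?P
     - first_order_part g h k u w x (f x) ?P) / 2" for k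
  have T: "T k = h (f x) (dird (dird f u) w x) (?P k)" for k
    unfolding T_def kos using sym[of u w] sym[of k u] sym[of k w]
      sy[of "?P u" "dird (dird f w) k x"] sy[of "?P w" "dird (dird f u) k x"]
    by simp
  define Z where "Z = (\<Sum>k\<in>Basis. T k *\<^sub>R sharp g x k)"
  have lin1: "linear (\<lambda>z. g x z v)" for v
    using riemannian_form_bilinear[OF g x] by (simp add: bilinear_def)
  have linT: "linear T"
    unfolding T using bl linear_compose[OF linP, of "h (f x) (dird (dird f u) w x)"]
    by (simp add: bilinear_def o_def)
  have gZ: "g x Z v = T v" for v
  proof -
    have "g x Z v = (\<Sum>k\<in>Basis. T k * (k \<bullet> v))"
      unfolding Z_def by (simp add: linear_sum[OF lin1] linear_scale[OF lin1] sharp[OF g x])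
    also have "\<dots> = T v"
      using linear_Basis_expansion[OF linT, of v] by (simp add: mult.commute inner_commute[of v])
    finally show ?thesis .
  qed
  \<comment> \<open>Positivity of \<open>g\<close> makes \<open>?P\<close> injective, hence
    bijective. It is therefore enough to test an identity in the target against vectors of the form
    \<open>?P a\<close>, where both sides reduce to \<open>T a\<close>.\<close>
  have "inj ?P"
  proof (subst linear_injective_0[OF linP], intro allI impI)
    fix a assume "?P a = 0"
    then have "g x a a = 0" using iso[of a a] bilinear_lzero[OF bl] by simp
    then show "a = 0" using riemannian_form_pos[OF g x, of a] by force
  qed
  then have "surj ?P" using linear_injective_imp_surjective[OF linP] by blast
  have "dird (dird f u) w x = ?P Z"
  proof (rule riemannian_form_eqI[OF h fx])
    fix v
    obtain a where "v = ?P a" using \<open>surj ?P\<close> by (metis surjD)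
    then show "h (f x) (dird (dird f u) w x) v = h (f x) (?P Z) v"
      using gZ[of a] iso[of Z a] T[of a] by simp
  qed
  also have "\<dots> = (\<Sum>k\<in>Basis. T k *\<^sub>R ?P (sharp g x k))"
    unfolding Z_def by (simp only: linear_sum[OF linP] linear_scale[OF linP])
  also have "\<dots> = hessian_rhs g h u w x (f x) ?P"
    unfolding hessian_rhs_def T_def
    using linear_Basis_expansion[OF linP, of "sharp g x _"] by simp
  finally show ?thesis .
qed

text \<open>\<open>y\<close> and \<open>P\<close> stand for arbitrary functions of class
  \<open>k\<close>. In the bootstrapping they are the limit map and its derivative.\<close>

lemma times_differentiable_on_hessian_rhs:
  assumes S: "open S" and V: "open V" and g: "riemannian_form S g" and h: "riemannian_form V h"
    and y: "times_differentiable_on k y S" "y ` S \<subseteq> V"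
    and P: "\<And>u. times_differentiable_on k (\<lambda>x. P x u) S"
  shows "times_differentiable_on k (\<lambda>x. hessian_rhs g h u w x (y x) (P x)) S"
proof -
  have *: "times_differentiable_on k (\<lambda>x. first_order_part g h w u v x (y x) (P x)) S" for w u v
    unfolding first_order_part_def
    using smooth_on_dird[OF riemannian_form_smooth[OF g]] smooth_on_dird[OF riemannian_form_smooth[OF h]]
    by (intro times_differentiable_on_diff times_differentiable_on_sum times_differentiable_on_mult
        times_differentiable_on_inner times_differentiable_on_const S P
        times_differentiable_on_compose[OF S V y(2) _ y(1)])
      (auto simp: smooth_on_def)
  have "times_differentiable_on k (\<lambda>x. \<Sum>k\<in>Basis.
     ((1/2) * (first_order_part g h u w k x (y x) (P x) + first_order_part g h w u k x (y x) (P x)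
       - first_order_part g h k u w x (y x) (P x))) *\<^sub>R
       (\<Sum>l\<in>Basis. (sharp g x k \<bullet> l) *\<^sub>R P x l)) S"
    using smooth_on_sharp[OF g S]
    by (intro times_differentiable_on_scaleR times_differentiable_on_sum times_differentiable_on_mult
        times_differentiable_on_inner times_differentiable_on_const S P *
        times_differentiable_on_add times_differentiable_on_diff)
      (auto simp: smooth_on_def)
  then show ?thesis unfolding hessian_rhs_def by simp
qed

text \<open>\<open>P\<close> ranges over the bounded linear maps, whose closed balls are compact
  here. Bounds and uniform continuity of the Hessian on compact sets of triples follow.\<close>

lemma continuous_on_hessian_rhs:
  assumes S: "open S" and g: "riemannian_form S g" and h: "riemannian_form V h"
  shows "continuous_on (S \<times> V \<times> UNIV) (\<lambda>(x, y, P). hessian_rhs g h u w x y (blinfun_apply P))"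
proof -
  have 1: "continuous_on (S \<times> V \<times> UNIV) (\<lambda>p. dird (\<lambda>x. g x a b) w (fst p))" for a b w
    by (rule continuous_on_compose2[OF smooth_on_continuous_on[OF smooth_on_dird[OF riemannian_form_smooth[OF g]]]])
      (auto intro!: continuous_intros)
  have 2: "continuous_on (S \<times> V \<times> UNIV) (\<lambda>p. dird (\<lambda>y. h y a b) c (fst (snd p)))" for a b c
    by (rule continuous_on_compose2[OF smooth_on_continuous_on[OF smooth_on_dird[OF riemannian_form_smooth[OF h]]]])
      (auto intro!: continuous_intros)
  have 3: "continuous_on (S \<times> V \<times> UNIV) (\<lambda>p. sharp g (fst p) k)" for k
    by (rule continuous_on_compose2[OF smooth_on_continuous_on[OF smooth_on_sharp[OF g S]]])
      (auto intro!: continuous_intros)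
  show ?thesis
    unfolding split_def hessian_rhs_def first_order_part_def
    by (intro continuous_intros 1 2 3) auto
qed

section \<open>Limits of local isometries\<close>

lemma preserves_forms_norm_bound:
  assumes "preserves_forms g h f S" "x \<in> S" "m > 0"
    "\<And>u. m * (norm u)\<^sup>2 \<le> h (f x) u u" "\<And>u. g x u u \<le> M * (norm u)\<^sup>2"
  shows "norm (dird f u x) \<le> sqrt (M / m) * norm u"
proof -
  have "m * (norm (dird f u x))\<^sup>2 \<le> M * (norm u)\<^sup>2"
    using assms(4)[of "dird f u x"] assms(5)[of u] assms(1,2) by (simp add: preserves_forms_def)
  then have "(norm (dird f u x))\<^sup>2 \<le> M / m * (norm u)\<^sup>2"
    using assms(3) by (simp add: field_simps)
  from real_le_rsqrt[OF this] show ?thesis by (simp only: real_sqrt_mult real_sqrt_abs abs_norm_cancel)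
qed

text \<open>The theorem on sequences of derivatives provides some limit function on
  \<open>S\<close>; uniqueness of pointwise limits identifies it with \<open>F\<close>, and openness
  of \<open>S\<close> removes the restriction to \<open>S\<close>.\<close>

lemma has_derivative_limit:
  fixes f :: "nat \<Rightarrow> 'a::real_normed_vector \<Rightarrow> 'b::banach"
  assumes "convex S" "open S"
    and derf: "\<And>n x. x \<in> S \<Longrightarrow> (f n has_derivative f' n x) (at x)"
    and nle: "\<And>e. e > 0 \<Longrightarrow> \<forall>\<^sub>F n in sequentially. \<forall>x\<in>S. \<forall>h. norm (f' n x h - g' x h) \<le> e * norm h"
    and lim: "\<And>x. x \<in> S \<Longrightarrow> (\<lambda>n. f n x) \<longlonglongrightarrow> F x"
    and x: "x \<in> S"
  shows "(F has_derivative g' x) (at x)"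
proof -
  obtain G where G: "\<And>x. x \<in> S \<Longrightarrow> (\<lambda>n. f n x) \<longlonglongrightarrow> G x"
      "\<And>x. x \<in> S \<Longrightarrow> (G has_derivative g' x) (at x within S)"
    using has_derivative_sequence[OF \<open>convex S\<close> has_derivative_at_withinI[OF derf] nle x lim[OF x]] by metis
  have "G y = F y" if "y \<in> S" for y using LIMSEQ_unique[OF G(1) lim] that by blast
  then have FG: "F y = G y" if "y \<in> S" for y using that by simp
  have "(G has_derivative g' x) (at x)" using G(2)[OF x] at_within_open[OF x \<open>open S\<close>] by simp
  then show ?thesis by (rule has_derivative_transform_open[OF _ \<open>open S\<close> x]) (rule FG)
qed

lemma norm_Basis_combination_le:
  fixes c :: "'e::euclidean_space \<Rightarrow> 'b::real_normed_vector"
  assumes "\<And>b. b \<in> Basis \<Longrightarrow> norm (c b) \<le> \<kappa> b"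
  shows "norm (\<Sum>b\<in>Basis. (w \<bullet> b) *\<^sub>R c b) \<le> (\<Sum>b\<in>Basis. \<kappa> b) * norm w"
proof -
  have "norm (\<Sum>b\<in>Basis. (w \<bullet> b) *\<^sub>R c b) \<le> (\<Sum>b\<in>Basis. norm ((w \<bullet> b) *\<^sub>R c b))" by (rule norm_sum)
  also have "\<dots> \<le> (\<Sum>b\<in>Basis. norm w * \<kappa> b)"
    by (intro sum_mono) (simp only: norm_scaleR real_norm_def, intro mult_mono Basis_le_norm assms, auto)
  finally show ?thesis by (simp add: sum_distrib_left mult.commute)
qed

text \<open>Landau's interpolation inequality between the zeroth and the second derivative.\<close>
lemma derivative_le_interpolation:
  fixes \<psi> :: "'a::euclidean_space \<Rightarrow> 'b::real_normed_vector"
  assumes \<psi>: "\<And>t. 0 \<le> t \<Longrightarrow> t \<le> s \<Longrightarrow> (\<psi> has_derivative D (x + t *\<^sub>R b)) (at (x + t *\<^sub>R b))"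
    and lip: "\<And>t. 0 \<le> t \<Longrightarrow> t \<le> s \<Longrightarrow> norm (D (x + t *\<^sub>R b) b - D x b) \<le> K * t"
    and small: "\<And>t. 0 \<le> t \<Longrightarrow> t \<le> s \<Longrightarrow> norm (\<psi> (x + t *\<^sub>R b)) \<le> \<delta>"
    and "s > 0" "K \<ge> 0"
  shows "norm (D x b) \<le> 2 * \<delta> / s + K * s"
proof -
  have vd: "((\<lambda>t. \<psi> (x + t *\<^sub>R b)) has_vector_derivative D (x + t *\<^sub>R b) b) (at t within {0..s})"
    if t: "t \<in> {0..s}" for t
  proof -
    have "((\<lambda>t. x + t *\<^sub>R b) has_derivative (\<lambda>h. h *\<^sub>R b)) (at t within {0..s})"
      by (auto intro!: derivative_eq_intros)
    from has_derivative_compose[OF this \<psi>]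
    have "((\<lambda>t. \<psi> (x + t *\<^sub>R b)) has_derivative (\<lambda>h. D (x + t *\<^sub>R b) (h *\<^sub>R b))) (at t within {0..s})"
      using t by simp
    moreover have "linear (D (x + t *\<^sub>R b))" using has_derivative_linear[OF \<psi>] t by simp
    ultimately show ?thesis
      unfolding has_vector_derivative_def using linear_scale[of "D (x + t *\<^sub>R b)"] by simp
  qed
  have "norm (\<psi> (x + s *\<^sub>R b) - \<psi> (x + 0 *\<^sub>R b) - (s - 0) *\<^sub>R D (x + 0 *\<^sub>R b) b) \<le> norm (s - 0) * (K * s)"
  proof (rule vector_differentiable_bound_linearization[where S="{0..s}" and f'="\<lambda>t. D (x + t *\<^sub>R b) b"])
    fix t assume "t \<in> {0..s}"
    then show "norm (D (x + t *\<^sub>R b) b - D (x + 0 *\<^sub>R b) b) \<le> K * s"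
      using lip[of t] mult_left_mono[of t s K] \<open>K \<ge> 0\<close> by simp
  qed (use vd \<open>s > 0\<close> in \<open>auto simp: closed_segment_eq_real_ivl\<close>)
  then have 1: "norm (\<psi> (x + s *\<^sub>R b) - \<psi> x - s *\<^sub>R D x b) \<le> s * (K * s)" using \<open>s > 0\<close> by simp
  have "s * norm (D x b) = norm (s *\<^sub>R D x b)" using \<open>s > 0\<close> by simp
  also have "\<dots> \<le> norm (\<psi> (x + s *\<^sub>R b)) + norm (\<psi> x) + norm (\<psi> (x + s *\<^sub>R b) - \<psi> x - s *\<^sub>R D x b)"
    by (smt (verit) norm_minus_commute norm_triangle_ineq4 norm_triangle_sub)
  also have "\<dots> \<le> 2 * \<delta> + s * (K * s)"
    using 1 small[of s] small[of 0] \<open>s > 0\<close> by simp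
  finally have "norm (D x b) \<le> (2 * \<delta> + s * (K * s)) / s"
    using \<open>s > 0\<close> by (simp add: field_simps)
  then show ?thesis using \<open>s > 0\<close> by (simp add: add_divide_distrib)
qed

text \<open>
  The Hessian of a local isometry is a function of its value and its first derivative. Hence the
  Hessians of the \<open>f n\<close> are uniformly bounded, so that the first derivatives converge as well; the
  limit satisfies the same equation and is smooth by bootstrapping.
\<close>
lemma limit_of_isometries:
  fixes f :: "nat \<Rightarrow> 'e::euclidean_space \<Rightarrow> 'e"
  assumes S: "open S" and V: "open V" and g: "riemannian_form S g" and h: "riemannian_form V h"
    and r: "r > 0" "cball x0 r \<subseteq> S" and C: "compact C" "C \<subseteq> V"
    and sm: "\<And>n. smooth_on (f n) (ball x0 r)" and fC: "\<And>n x. x \<in> ball x0 r \<Longrightarrow> f n x \<in> C"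
    and iso: "\<And>n. preserves_forms g h (f n) (ball x0 r)"
    and lim: "uniform_limit (ball x0 r) f F sequentially"
  shows "smooth_on F (ball x0 (r/2))" "preserves_forms g h F (ball x0 (r/2))"
proof -
  \<comment> \<open>From a point of the half ball one can move by less than \<open>r/2\<close> in
    any basis direction without leaving \<open>B\<close>; the interpolation inequality needs this
    room.\<close>
  define B B' where "B = ball x0 r" and "B' = ball x0 (r/2)"
  have B: "open B" "convex B" "B \<subseteq> cball x0 r" and B': "open B'" "convex B'" "B' \<subseteq> B"
    using r by (auto simp: B_def B'_def)
  have gB: "riemannian_form B g" and gB': "riemannian_form B' g"
    using riemannian_form_subset[OF g] B(3) B'(3) r(2) by auto
  note sm = sm[folded B_def] and fC = fC[folded B_def] and iso = iso[folded B_def] and lim = lim[folded B_def]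
  have fV: "f n ` B \<subseteq> V" for n using fC C by blast
  define P where "P n x = Blinfun (\<lambda>w. dird (f n) w x)" for n x
  have P: "blinfun_apply (P n x) = (\<lambda>w. dird (f n) w x)" if "x \<in> B" for n x
    unfolding P_def
    by (rule bounded_linear_Blinfun_apply[OF has_derivative_bounded_linear[OF smooth_on_has_derivative[OF sm that]]])
  have derf: "(f n has_derivative P n x) (at x)" if "x \<in> B" for n x
    using smooth_on_has_derivative[OF sm that] P[OF that] by simp
  obtain M where M: "M > 0" "\<And>x u. x \<in> cball x0 r \<Longrightarrow> g x u u \<le> M * (norm u)\<^sup>2"
    using riemannian_form_bounds[OF g compact_cball r(2)] by metis
  obtain m where m: "m > 0" "\<And>x u. x \<in> C \<Longrightarrow> m * (norm u)\<^sup>2 \<le> h x u u"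
    using riemannian_form_bounds[OF h C] by metis
  define L where "L = sqrt (M / m)"
  have PL: "norm (P n x) \<le> L" if x: "x \<in> B" for n x
  proof (rule norm_blinfun_bound)
    show "norm (blinfun_apply (P n x) u) \<le> L * norm u" for u
      unfolding P[OF x] L_def
      using preserves_forms_norm_bound[OF iso x m(1) m(2)[OF fC[OF x]] M(2)] B(3) x by blast
  qed (use M m in \<open>simp add: L_def\<close>)
  \<comment> \<open>One compact set contains the triples of point, value and derivative for all
    \<open>n\<close>. It yields bounds on the Hessians that do not depend on \<open>n\<close>, and
    uniform continuity of the Hessian formula.\<close>
  define Q where "Q = cball x0 r \<times> C \<times> cball (0 :: 'e \<Rightarrow>\<^sub>L 'e) L"
  have cQ: "compact Q" unfolding Q_def using C by (intro compact_Times) auto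
  have inQ: "(x, f n x, P n x) \<in> Q" if "x \<in> B" for n x
    using PL[OF that] fC[OF that] that B(3) by (auto simp: Q_def)
  define \<Phi> where "\<Phi> u w = (\<lambda>(x, y, P). hessian_rhs g h u w x y (blinfun_apply P))" for u w
  have ct: "continuous_on Q (\<Phi> u w)" for u w
    unfolding \<Phi>_def by (rule continuous_on_subset[OF continuous_on_hessian_rhs[OF S g h]])
      (use r C in \<open>auto simp: Q_def\<close>)
  have der2: "((\<lambda>x. P n x u) has_derivative (\<lambda>w. \<Sum>b\<in>Basis. (w \<bullet> b) *\<^sub>R \<Phi> u b (x, f n x, P n x))) (at x)"
    if x: "x \<in> B" for n u x
  proof -
    note D = smooth_on_has_derivative[OF smooth_on_dird[OF sm] x]
    have "dird (dird (f n) u) w x = (\<Sum>b\<in>Basis. (w \<bullet> b) *\<^sub>R \<Phi> u b (x, f n x, P n x))" for w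
      using linear_Basis_expansion[OF has_derivative_linear[OF D], of n u w]
        second_derivative_of_isometry[OF B(1) V gB h sm fV iso x]
      by (simp add: \<Phi>_def P[OF x])
    then have "((\<lambda>x. dird (f n) u x) has_derivative (\<lambda>w. \<Sum>b\<in>Basis. (w \<bullet> b) *\<^sub>R \<Phi> u b (x, f n x, P n x))) (at x)"
      using D[of n u] by simp
    then show ?thesis
      by (rule has_derivative_transform_open[OF _ B(1) x]) (simp add: P)
  qed
  have "\<exists>K. K \<ge> 0 \<and> (\<forall>q\<in>Q. norm (\<Phi> u w q) \<le> K)" for u w
  proof -
    have "bounded (\<Phi> u w ` Q)" using compact_continuous_image[OF ct cQ] compact_imp_bounded by blast
    then obtain K where "\<forall>q\<in>Q. norm (\<Phi> u w q) \<le> K" by (auto simp: bounded_iff)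
    then show ?thesis by (intro exI[of _ "max 0 K"]) (auto simp: le_max_iff_disj)
  qed
  then obtain \<kappa> where \<kappa>: "\<And>u w. \<kappa> u w \<ge> 0" "\<And>u w q. q \<in> Q \<Longrightarrow> norm (\<Phi> u w q) \<le> \<kappa> u w" by metis
  \<comment> \<open>Summing over \<open>u\<close> gives a common Lipschitz constant for the
    derivatives in all basis directions; adding 1 makes it positive, as it occurs in a denominator
    below.\<close>
  define K where "K = (\<Sum>u\<in>Basis. \<Sum>b\<in>Basis. \<kappa> u b) + 1"
  have K: "K > 0" unfolding K_def using \<kappa> by (intro add_nonneg_pos sum_nonneg) auto
  have lip: "norm (P n x u - P n y u) \<le> K * norm (x - y)" if u: "u \<in> Basis" and "x \<in> B" "y \<in> B" for n u x y
  proof (rule differentiable_bound[OF B(2) has_derivative_at_withinI[OF der2] _ that(2,3)])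
    fix x assume x: "x \<in> B"
    show "onorm (\<lambda>w. \<Sum>b\<in>Basis. (w \<bullet> b) *\<^sub>R \<Phi> u b (x, f n x, P n x)) \<le> K"
    proof (rule onorm_le)
      fix w
      have "norm (\<Sum>b\<in>Basis. (w \<bullet> b) *\<^sub>R \<Phi> u b (x, f n x, P n x)) \<le> (\<Sum>b\<in>Basis. \<kappa> u b) * norm w"
        by (rule norm_Basis_combination_le) (rule \<kappa>(2)[OF inQ[OF x]])
      also have "\<dots> \<le> K * norm w"
      proof (rule mult_right_mono)
        have "(\<Sum>b\<in>Basis. \<kappa> u b) \<le> (\<Sum>u\<in>Basis. \<Sum>b\<in>Basis. \<kappa> u b)"
          by (rule member_le_sum[OF u]) (auto intro!: sum_nonneg \<kappa>)
        then show "(\<Sum>b\<in>Basis. \<kappa> u b) \<le> K" by (simp add: K_def)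
      qed simp
      finally show "norm (\<Sum>b\<in>Basis. (w \<bullet> b) *\<^sub>R \<Phi> u b (x, f n x, P n x)) \<le> K * norm w" .
    qed
  qed
  \<comment> \<open>Interpolation for the difference of \<open>f n\<close> and \<open>f k\<close>:
    its derivative in direction \<open>b\<close> has Lipschitz constant \<open>2 * K\<close> along
    \<open>b\<close>, independently of \<open>n\<close> and \<open>k\<close>.\<close>
  have interp: "norm (P n x b - P k x b) \<le> 2 * \<delta> / s + 2 * K * s"
    if x: "x \<in> B'" and b: "b \<in> Basis" and s: "0 < s" "s < r/2"
      and \<delta>: "\<And>y. y \<in> B \<Longrightarrow> dist (f n y) (f k y) \<le> \<delta>" for n k x b s \<delta>
  proof -
    have inB: "x + t *\<^sub>R b \<in> B" if "0 \<le> t" "t \<le> s" for t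
    proof -
      have "dist x0 (x + t *\<^sub>R b) \<le> dist x0 x + norm (t *\<^sub>R b)"
        using norm_triangle_ineq4[of "x0 - x" "t *\<^sub>R b"] by (simp add: dist_norm algebra_simps)
      then show ?thesis using x b s that by (simp add: B_def B'_def)
    qed
    have xB: "x \<in> B" using x B'(3) by auto
    have "norm (blinfun_apply (P n x - P k x) b) \<le> 2 * \<delta> / s + (2 * K) * s"
    proof (rule derivative_le_interpolation[where \<psi>="\<lambda>y. f n y - f k y" and D="\<lambda>y. blinfun_apply (P n y - P k y)"])
      fix t assume t: "0 \<le> t" "t \<le> s"
      show "((\<lambda>y. f n y - f k y) has_derivative blinfun_apply (P n (x + t *\<^sub>R b) - P k (x + t *\<^sub>R b))) (at (x + t *\<^sub>R b))"
        using has_derivative_diff[OF derf[OF inB[OF t]] derf[OF inB[OF t]], of n k]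
        by (simp add: minus_blinfun.rep_eq)
      show "norm (f n (x + t *\<^sub>R b) - f k (x + t *\<^sub>R b)) \<le> \<delta>"
        using \<delta>[OF inB[OF t]] by (simp add: dist_norm)
      have "norm (P j (x + t *\<^sub>R b) b - P j x b) \<le> K * t" for j
        using lip[OF b inB[OF t] xB, of j] b t by simp
      from this[of n] this[of k]
      show "norm (blinfun_apply (P n (x + t *\<^sub>R b) - P k (x + t *\<^sub>R b)) b - blinfun_apply (P n x - P k x) b) \<le> 2 * K * t"
        using norm_triangle_ineq4[of "P n (x + t *\<^sub>R b) b - P n x b" "P k (x + t *\<^sub>R b) b - P k x b"]
        by (simp add: minus_blinfun.rep_eq algebra_simps)
    qed (use s K in auto)
    then show ?thesis by (simp add: minus_blinfun.rep_eq)
  qed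
  have "uniformly_Cauchy_on B' P"
    unfolding uniformly_Cauchy_on_def
  proof (intro allI impI)
    fix e :: real assume e: "e > 0"
    define N where "N = real DIM('e)"
    have N: "N > 0" by (simp add: N_def)
    \<comment> \<open>The step is fixed before the accuracy: \<open>s\<close> makes the curvature
      term at most \<open>e / (4 * N)\<close>, and then \<open>\<delta>\<close> makes the other term
      equal to \<open>e / (4 * N)\<close>. Summing over the \<open>N\<close> basis vectors bounds
      the operator norm by \<open>e / 2\<close>.\<close>
    define s where "s = min (r/4) (e / (8 * K * N))"
    have s: "0 < s" "s < r/2" and sK: "2 * K * s \<le> e / (4 * N)"
    proof -
      show "0 < s" "s < r/2" using r K N e by (auto simp: s_def)
      have "s \<le> e / (8 * K * N)" by (simp add: s_def)
      then have "2 * K * s \<le> 2 * K * (e / (8 * K * N))" using K by (intro mult_left_mono) auto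
      then show "2 * K * s \<le> e / (4 * N)" using K by simp
    qed
    define \<delta> where "\<delta> = e * s / (8 * N)"
    have "\<delta> > 0" using e s N by (simp add: \<delta>_def)
    moreover have "uniformly_Cauchy_on B f"
      using lim uniformly_convergent_Cauchy uniformly_convergent_on_def by blast
    ultimately obtain n0 where n0: "\<And>x n k. x \<in> B \<Longrightarrow> n \<ge> n0 \<Longrightarrow> k \<ge> n0 \<Longrightarrow> dist (f n x) (f k x) < \<delta>"
      unfolding uniformly_Cauchy_on_def by metis
    have "dist (P n x) (P k x) < e" if x: "x \<in> B'" and n: "n \<ge> n0" "k \<ge> n0" for x n k
    proof -
      have "norm (P n x b - P k x b) \<le> e / (2 * N)" if b: "b \<in> Basis" for b
      proof -
        have "norm (P n x b - P k x b) \<le> 2 * \<delta> / s + 2 * K * s"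
          using interp[OF x b s] n0[OF _ n] by (meson less_imp_le)
        also have "2 * \<delta> / s = e / (4 * N)" using s N by (simp add: \<delta>_def)
        finally show ?thesis using sK by (simp add: field_simps)
      qed
      then have "(\<Sum>b\<in>Basis. norm (P n x b - P k x b)) \<le> N * (e / (2 * N))"
        unfolding N_def by (rule sum_bounded_above)
      then have "(\<Sum>b\<in>Basis. norm ((P n x - P k x) b)) \<le> e / 2"
        using N by (simp add: minus_blinfun.rep_eq)
      then have "norm (P n x - P k x) \<le> e / 2" using norm_blinfun_euclidean_le order_trans by blast
      then show ?thesis using e by (simp add: dist_norm)
    qed
    then show "\<exists>n0. \<forall>x\<in>B'. \<forall>n\<ge>n0. \<forall>k\<ge>n0. dist (P n x) (P k x) < e" by blast
  qed
  then obtain Pl where Pl: "uniform_limit B' P Pl sequentially"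
    using Cauchy_uniformly_convergent uniformly_convergent_on_def by blast
  have limP: "(\<lambda>n. P n x) \<longlonglongrightarrow> Pl x" if "x \<in> B'" for x using tendsto_uniform_limitI[OF Pl that] .
  have limf: "(\<lambda>n. f n x) \<longlonglongrightarrow> F x" if "x \<in> B'" for x
    using tendsto_uniform_limitI[OF lim] that B'(3) by blast
  have FC: "F x \<in> C" if "x \<in> B'" for x
    using Lim_in_closed_set[OF compact_imp_closed[OF C(1)] _ _ limf[OF that]] fC that B'(3) by auto
  have dF: "(F has_derivative Pl x) (at x)" if x: "x \<in> B'" for x
  proof (rule has_derivative_limit[OF B'(2,1) _ _ limf x])
    show "(f n has_derivative P n x) (at x)" if "x \<in> B'" for n x using derf that B'(3) by blast
    fix e :: real assume "e > 0"
    then have "\<forall>\<^sub>F n in sequentially. \<forall>x\<in>B'. dist (P n x) (Pl x) < e" using Pl by (simp add: uniform_limit_iff)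
    then show "\<forall>\<^sub>F n in sequentially. \<forall>x\<in>B'. \<forall>h. norm (P n x h - Pl x h) \<le> e * norm h"
    proof eventually_elim
      case (elim n)
      show ?case
      proof (intro ballI allI)
        fix x h assume "x \<in> B'"
        then have "norm (P n x - Pl x) \<le> e" using elim by (auto simp: dist_norm)
        then have "norm ((P n x - Pl x) h) \<le> e * norm h"
          using norm_blinfun[of "P n x - Pl x" h] mult_right_mono[of _ e "norm h"] by (meson norm_ge_zero order_trans)
        then show "norm (P n x h - Pl x h) \<le> e * norm h" by (simp add: minus_blinfun.rep_eq)
      qed
    qed
  qed
  \<comment> \<open>The triples converge uniformly inside the closed set \<open>Q\<close>. Uniform
    continuity on \<open>Q\<close> carries this over to the second derivatives, so \<open>Pl\<close>
    can be differentiated in turn.\<close>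
  have "uniform_limit B' (\<lambda>n x. (x, f n x, P n x)) (\<lambda>x. (x, F x, Pl x)) sequentially"
    unfolding uniform_limit_iff
  proof (intro allI impI)
    fix e :: real assume "e > 0"
    then have "\<forall>\<^sub>F n in sequentially. \<forall>x\<in>B'. dist (P n x) (Pl x) < e/2"
      "\<forall>\<^sub>F n in sequentially. \<forall>x\<in>B. dist (f n x) (F x) < e/2"
      using Pl lim half_gt_zero unfolding uniform_limit_iff by blast+
    then show "\<forall>\<^sub>F n in sequentially. \<forall>x\<in>B'. dist (x, f n x, P n x) (x, F x, Pl x) < e"
    proof eventually_elim
      case (elim n)
      show ?case
      proof
        fix x assume x: "x \<in> B'"
        have "dist (x, f n x, P n x) (x, F x, Pl x) \<le> dist (f n x) (F x) + dist (P n x) (Pl x)"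
          by (simp add: dist_Pair_Pair sqrt_sum_squares_le_sum)
        then show "dist (x, f n x, P n x) (x, F x, Pl x) < e" using elim x B'(3) by fastforce
      qed
    qed
  qed
  from uniform_limit_compose_uniformly_continuous_on[OF this compact_uniformly_continuous[OF ct cQ] _ compact_imp_closed[OF cQ]]
  have lim\<Phi>: "uniform_limit B' (\<lambda>n x. \<Phi> u w (x, f n x, P n x)) (\<lambda>x. \<Phi> u w (x, F x, Pl x)) sequentially" for u w
    using inQ B'(3) by (simp add: subset_eq)
  have d2F: "((\<lambda>x. Pl x u) has_derivative (\<lambda>w. \<Sum>b\<in>Basis. (w \<bullet> b) *\<^sub>R \<Phi> u b (x, F x, Pl x))) (at x)"
    if x: "x \<in> B'" for u x
  proof (rule has_derivative_limit[OF B'(2,1) _ _ _ x])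
    show "((\<lambda>x. P n x u) has_derivative (\<lambda>w. \<Sum>b\<in>Basis. (w \<bullet> b) *\<^sub>R \<Phi> u b (x, f n x, P n x))) (at x)"
      if "x \<in> B'" for n x using der2 that B'(3) by blast
    show "(\<lambda>n. P n x u) \<longlonglongrightarrow> Pl x u" if "x \<in> B'" for x
      by (intro tendsto_intros limP that)
    fix e :: real assume e: "e > 0"
    have "\<forall>\<^sub>F n in sequentially. \<forall>x\<in>B'. dist (\<Phi> u b (x, f n x, P n x)) (\<Phi> u b (x, F x, Pl x)) < e / DIM('e)" for b
      using lim\<Phi>[of u b] e unfolding uniform_limit_iff by simp
    then have "\<forall>\<^sub>F n in sequentially. \<forall>b\<in>(Basis::'e set). \<forall>x\<in>B'. dist (\<Phi> u b (x, f n x, P n x)) (\<Phi> u b (x, F x, Pl x)) < e / DIM('e)"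
      by (intro eventually_ball_finite) auto
    then show "\<forall>\<^sub>F n in sequentially. \<forall>x\<in>B'. \<forall>w. norm ((\<Sum>b\<in>Basis. (w \<bullet> b) *\<^sub>R \<Phi> u b (x, f n x, P n x)) -
       (\<Sum>b\<in>Basis. (w \<bullet> b) *\<^sub>R \<Phi> u b (x, F x, Pl x))) \<le> e * norm w"
    proof eventually_elim
      case (elim n)
      show ?case
      proof (intro ballI allI)
        fix x w assume x: "x \<in> B'"
        have "norm (\<Sum>b\<in>Basis. (w \<bullet> b) *\<^sub>R (\<Phi> u b (x, f n x, P n x) - \<Phi> u b (x, F x, Pl x)))
           \<le> (\<Sum>b\<in>(Basis::'e set). e / DIM('e)) * norm w"
          using elim x by (intro norm_Basis_combination_le) (auto simp: dist_norm intro!: less_imp_le)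
        then show "norm ((\<Sum>b\<in>Basis. (w \<bullet> b) *\<^sub>R \<Phi> u b (x, f n x, P n x)) -
           (\<Sum>b\<in>Basis. (w \<bullet> b) *\<^sub>R \<Phi> u b (x, F x, Pl x))) \<le> e * norm w"
          by (simp add: scaleR_diff_right sum_subtractf)
      qed
    qed
  qed
  \<comment> \<open>Joint induction: the derivative of \<open>F\<close> is \<open>Pl\<close>, and
    that of \<open>Pl\<close> is a smooth expression in the point, \<open>F\<close> and
    \<open>Pl\<close>. Hence both gain one order at a time.\<close>
  have "times_differentiable_on k F B' \<and> (\<forall>u. times_differentiable_on k (\<lambda>x. Pl x u) B')" for k
  proof (induction k)
    case 0
    then show ?case
      using has_derivative_continuous[OF dF] has_derivative_continuous[OF d2F]
      by (auto intro!: continuous_at_imp_continuous_on)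
  next
    case (Suc k)
    have "times_differentiable_on k (\<lambda>x. \<Sum>b\<in>Basis. (w \<bullet> b) *\<^sub>R \<Phi> u b (x, F x, Pl x)) B'" for u w
      unfolding \<Phi>_def prod.case
      using Suc FC C(2)
      by (intro times_differentiable_on_sum times_differentiable_on_scaleR times_differentiable_on_const
          times_differentiable_on_hessian_rhs[OF B'(1) V gB' h] B') auto
    then show ?case
      using Suc times_differentiable_on_SucI[OF B'(1) dF] times_differentiable_on_SucI[OF B'(1) d2F]
      by blast
  qed
  then show "smooth_on F (ball x0 (r/2))" by (simp add: smooth_on_def B'_def)
  show "preserves_forms g h F (ball x0 (r/2))"
    unfolding preserves_forms_def B'_def[symmetric]
  proof (intro ballI allI)
    fix x u v assume x: "x \<in> B'"
    then have xB: "x \<in> B" using B'(3) by auto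
    have dird: "dird F u x = Pl x u" for u using frechet_derivative_at[OF dF[OF x]] by metis
    have "(\<lambda>n. (f n x, P n x u, P n x v)) \<longlonglongrightarrow> (F x, Pl x u, Pl x v)"
      by (intro tendsto_intros limP limf x)
    from continuous_on_tendsto_compose[OF riemannian_form_continuous_on[OF h] this]
    have "(\<lambda>n. h (f n x) (P n x u) (P n x v)) \<longlonglongrightarrow> h (F x) (Pl x u) (Pl x v)"
      using FC[OF x] fC[OF xB] C(2) by (auto simp: subset_eq)
    moreover have "h (f n x) (P n x u) (P n x v) = g x u v" for n
      using iso xB by (simp add: preserves_forms_def P)
    ultimately have "h (F x) (Pl x u) (Pl x v) = g x u v" by (simp add: LIMSEQ_const_iff)
    then show "h (F x) (dird F u x) (dird F v x) = g x u v" by (simp add: dird)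
  qed
qed

section \<open>Charts and even continuity of isometries\<close>

definition coord_form :: "('m, 'e) metric_tensor \<Rightarrow> ('m, 'e::euclidean_space) chart \<Rightarrow> 'e \<Rightarrow> 'e \<Rightarrow> 'e \<Rightarrow> real" where
  "coord_form g c x u v = g c (param c x) u v"

abbreviation chart_image :: "('m, 'e) chart \<Rightarrow> 'e set" where
  "chart_image c \<equiv> coord c ` dom_of c"

lemma
  assumes "is_chart c"
  shows chart_open: "open (dom_of c)" "open (chart_image c)"
    and chart_continuous: "continuous_on (dom_of c) (coord c)" "continuous_on (chart_image c) (param c)"
    and param_coord: "p \<in> dom_of c \<Longrightarrow> param c (coord c p) = p"
    and coord_param: "x \<in> chart_image c \<Longrightarrow> coord c (param c x) = x"
    and param_in_dom: "x \<in> chart_image c \<Longrightarrow> param c x \<in> dom_of c"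
  using assms unfolding is_chart_def homeomorphism_def by auto

lemma open_coord_vimage:
  "is_chart c \<Longrightarrow> open T \<Longrightarrow> open (dom_of c \<inter> coord c -` T)"
  using continuous_open_preimage[OF chart_continuous(1) chart_open(1)] by blast

lemma open_coord_image:
  assumes c: "is_chart c" and T: "open T"
  shows "open (coord c ` (dom_of c \<inter> T))"
proof -
  have "coord c ` (dom_of c \<inter> T) = chart_image c \<inter> param c -` T"
    using param_coord[OF c] param_in_dom[OF c] coord_param[OF c] by (force simp: image_iff)
  then show ?thesis using continuous_open_preimage[OF chart_continuous(2)[OF c] chart_open(2)[OF c] T] by simp
qed

lemma isometriesD:
  assumes "f \<in> isometries A g"
  shows "bij f" "continuous_on UNIV f" "smooth_map A f" "smooth_map A (inv_into UNIV f)"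
    and "c \<in> A \<Longrightarrow> d \<in> A \<Longrightarrow> p \<in> dom_of c \<Longrightarrow> f p \<in> dom_of d \<Longrightarrow>
      g d (f p) (differential c d f p u) (differential c d f p v) = g c p u v"
  using assms by (auto simp: isometries_def smooth_map_def)

text \<open>Kelley's even continuity, strengthened twice. Any point of \<open>U\<close> may trigger
  the conclusion and not only \<open>x\<close>, which permits arguing from a neighbour back to
  \<open>x\<close>. The images lie in a compact part of \<open>V\<close>, hence in a closed one, so
  the condition survives pointwise limits.\<close>

definition evenly_continuous :: "('m::topological_space \<Rightarrow> 'm) set \<Rightarrow> bool" where
  "evenly_continuous H \<longleftrightarrow> (\<forall>x y V. open V \<and> y \<in> V \<longrightarrow>
     (\<exists>U V' K. open U \<and> x \<in> U \<and> open V' \<and> y \<in> V' \<and> compact K \<and> K \<subseteq> V \<and>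
        (\<forall>h\<in>H. \<forall>u\<in>U. h u \<in> V' \<longrightarrow> h ` U \<subseteq> K)))"

lemma evenly_continuousE:
  assumes "evenly_continuous H" "open V" "y \<in> V"
  obtains U V' K where "open U" "x \<in> U" "open V'" "y \<in> V'" "compact K" "K \<subseteq> V"
    "\<forall>h\<in>H. \<forall>u\<in>U. h u \<in> V' \<longrightarrow> (\<forall>w\<in>U. h w \<in> K)"
proof -
  obtain U V' K where *: "open U" "x \<in> U" "open V'" "y \<in> V'" "compact K" "K \<subseteq> V"
    "\<forall>h\<in>H. \<forall>u\<in>U. h u \<in> V' \<longrightarrow> h ` U \<subseteq> K"
    using assms unfolding evenly_continuous_def by metis
  show ?thesis by (rule that[OF *(1-6)]) (use *(7) in blast)
qed

lemma evenly_continuous_subset: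
  fixes H :: "('m::topological_space \<Rightarrow> 'm) set"
  shows "evenly_continuous H \<Longrightarrow> H' \<subseteq> H \<Longrightarrow> evenly_continuous H'"
  unfolding evenly_continuous_def
proof (intro allI impI)
  fix x y :: 'm and V
  assume H: "\<forall>x y V. open V \<and> y \<in> V \<longrightarrow> (\<exists>U V' K. open U \<and> x \<in> U \<and> open V' \<and> y \<in> V' \<and> compact K \<and> K \<subseteq> V \<and>
        (\<forall>h\<in>H. \<forall>u\<in>U. h u \<in> V' \<longrightarrow> h ` U \<subseteq> K))" and "H' \<subseteq> H" and V: "open V \<and> y \<in> V"
  from H[rule_format, OF V, of x] obtain U V' K where
    "open U \<and> x \<in> U \<and> open V' \<and> y \<in> V' \<and> compact K \<and> K \<subseteq> V \<and> (\<forall>h\<in>H. \<forall>u\<in>U. h u \<in> V' \<longrightarrow> h ` U \<subseteq> K)"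
    by blast
  with \<open>H' \<subseteq> H\<close> show "\<exists>U V' K. open U \<and> x \<in> U \<and> open V' \<and> y \<in> V' \<and> compact K \<and> K \<subseteq> V \<and>
        (\<forall>h\<in>H'. \<forall>u\<in>U. h u \<in> V' \<longrightarrow> h ` U \<subseteq> K)"
    by (intro exI[of _ U] exI[of _ V'] exI[of _ K]) blast
qed

section \<open>Isometries of a Riemannian manifold read in charts\<close>

locale riemannian =
  fixes A :: "('m::{second_countable_topology,t2_space}, 'e::euclidean_space) chart set"
    and g :: "('m, 'e) metric_tensor"
  assumes manifold: "riemannian_manifold A g"
begin

lemma chart: "c \<in> A \<Longrightarrow> is_chart c"
  using manifold by (simp add: riemannian_manifold_def smooth_atlas_def)

lemma chart_at: obtains c where "c \<in> A" "p \<in> dom_of c"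
  using manifold unfolding riemannian_manifold_def smooth_atlas_def by blast

lemma riemannian_form_coord:
  assumes c: "c \<in> A" shows "riemannian_form (chart_image c) (coord_form g c)"
proof -
  have m: "riemannian_metric A g" using manifold by (simp add: riemannian_manifold_def)
  have e: "coord_form g c x = g c (param c x)" for x by (rule ext)+ (simp add: coord_form_def)
  show ?thesis
    unfolding riemannian_form_def
  proof (intro conjI ballI)
    fix x assume "x \<in> chart_image c"
    then have "param c x \<in> dom_of c" by (rule param_in_dom[OF chart[OF c]])
    then show "bilinear (coord_form g c x)" "\<forall>u v. coord_form g c x u v = coord_form g c x v u"
      "\<forall>u. u \<noteq> 0 \<longrightarrow> coord_form g c x u u > 0"
      using m c unfolding riemannian_metric_def e by blast+
  next
    show "\<forall>u v. smooth_on (\<lambda>x. coord_form g c x u v) (chart_image c)"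
      using m c unfolding riemannian_metric_def coord_form_def by blast
  qed
qed

lemma isometry_in_charts:
  assumes f: "f \<in> isometries A g" and c: "c \<in> A" and d: "d \<in> A"
  defines "S \<equiv> coord c ` (dom_of c \<inter> f -` dom_of d)"
  shows "open S" "smooth_on (coord d \<circ> f \<circ> param c) S"
    "preserves_forms (coord_form g c) (coord_form g d) (coord d \<circ> f \<circ> param c) S"
proof -
  have "open (f -` dom_of d)"
    using open_vimage[OF chart_open(1)[OF chart[OF d]] isometriesD(2)[OF f]] .
  then show "open S" unfolding S_def by (rule open_coord_image[OF chart[OF c]])
  show "smooth_on (coord d \<circ> f \<circ> param c) S"
    using isometriesD(3)[OF f] c d unfolding smooth_map_def S_def by blast
  show "preserves_forms (coord_form g c) (coord_form g d) (coord d \<circ> f \<circ> param c) S"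
    unfolding preserves_forms_def
  proof (intro ballI allI)
    fix x u v assume "x \<in> S"
    then obtain p where p: "p \<in> dom_of c" "f p \<in> dom_of d" "x = coord c p" by (auto simp: S_def)
    show "coord_form g d ((coord d \<circ> f \<circ> param c) x) (dird (coord d \<circ> f \<circ> param c) u x)
       (dird (coord d \<circ> f \<circ> param c) v x) = coord_form g c x u v"
      using isometriesD(5)[OF f c d p(1,2), of u v] p param_coord[OF chart[OF c] p(1)]
        param_coord[OF chart[OF d] p(2)]
      by (simp add: coord_form_def differential_def)
  qed
qed

text \<open>Smoothness of the inverse belongs to the definition of an isometry. For the metric, the
  chain rule applied to \<open>f\<close> after its inverse shows that the two differentials compose
  to the identity, so the equation for \<open>f\<close> can be read backwards.\<close>

lemma inv_isometry:
  assumes f: "f \<in> isometries A g" shows "inv_into UNIV f \<in> isometries A g"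
proof -
  let ?f' = "inv_into UNIV f"
  have b: "bij f" using isometriesD[OF f] by simp
  have ff': "f (?f' p) = p" for p using b by (simp add: bij_is_surj surj_f_inv_f)
  have "g d (?f' p) (differential c d ?f' p u) (differential c d ?f' p v) = g c p u v"
    if c: "c \<in> A" and d: "d \<in> A" and p: "p \<in> dom_of c" "?f' p \<in> dom_of d" for c d p u v
  proof -
    define q where "q = ?f' p"
    have q: "q \<in> dom_of d" "f q = p" using p ff' by (auto simp: q_def)
    let ?\<phi> = "coord c \<circ> f \<circ> param d" and ?\<chi> = "coord d \<circ> ?f' \<circ> param c"
    have pc[simp]: "param c (coord c p) = p" "param d (coord d q) = q"
      using param_coord chart c d p q by blast+
    have "open (?f' -` dom_of d)"
      using isometriesD(4)[OF f]
      by (intro open_vimage chart_open(1) chart d) (simp add: smooth_map_def)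
    then have op: "open (coord c ` (dom_of c \<inter> ?f' -` dom_of d))" (is "open ?S")
      by (rule open_coord_image[OF chart[OF c]])
    have "smooth_on ?\<chi> ?S" using isometriesD(4)[OF f] c d unfolding smooth_map_def by blast
    moreover have xS: "coord c p \<in> ?S" using p by blast
    ultimately have D\<chi>: "(?\<chi> has_derivative frechet_derivative ?\<chi> (at (coord c p))) (at (coord c p))"
      using smooth_on_has_derivative by blast
    have "?\<chi> (coord c p) = coord d q" by (simp add: q_def)
    moreover have "coord d q \<in> coord d ` (dom_of d \<inter> f -` dom_of c)" using p q by auto
    from smooth_on_has_derivative[OF isometry_in_charts(2)[OF f d c] this]
    have "(?\<phi> has_derivative frechet_derivative ?\<phi> (at (coord d q))) (at (coord d q))" by simp
    ultimately have "((\<lambda>x. ?\<phi> (?\<chi> x)) has_derivative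
        (\<lambda>w. dird ?\<phi> (dird ?\<chi> w (coord c p)) (coord d q))) (at (coord c p))"
      using has_derivative_compose[OF D\<chi>, of ?\<phi>] by simp
    then have "((\<lambda>x. x) has_derivative
        (\<lambda>w. dird ?\<phi> (dird ?\<chi> w (coord c p)) (coord d q))) (at (coord c p))"
      by (rule has_derivative_transform_open[OF _ op xS])
        (use param_coord[OF chart[OF c]] param_coord[OF chart[OF d]] in \<open>auto simp: ff'\<close>)
    from has_derivative_unique[OF this has_derivative_ident]
    have inv: "dird ?\<phi> (dird ?\<chi> w (coord c p)) (coord d q) = w" for w by (simp add: fun_eq_iff)
    have "g c (f q) (differential d c f q (differential c d ?f' p u)) (differential d c f q (differential c d ?f' p v))
      = g d q (differential c d ?f' p u) (differential c d ?f' p v)"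
      using isometriesD(5)[OF f d c q(1)] q(2) p(1) by simp
    then show ?thesis using inv unfolding differential_def by (simp add: q_def[symmetric] q(2))
  qed
  then show ?thesis
    using isometriesD[OF f] b unfolding isometries_def
    by (auto simp: inv_inv_eq bij_imp_bij_inv)
qed

text \<open>
  Straight segments in a chart around \<open>x\<close> are mapped to short curves; if such a curve starts
  near \<open>y\<close>, it cannot leave a coordinate ball around \<open>y\<close>.
\<close>
lemma evenly_continuous_isometries: "evenly_continuous (isometries A g)"
  unfolding evenly_continuous_def
proof (intro allI impI)
  fix x y and V :: "'m set" assume V: "open V \<and> y \<in> V"
  obtain c where c: "c \<in> A" "x \<in> dom_of c" by (rule chart_at)
  obtain d where d: "d \<in> A" "y \<in> dom_of d" by (rule chart_at)
  note cc = chart[OF c(1)] and dd = chart[OF d(1)]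
  define x0 y0 where "x0 = coord c x" and "y0 = coord d y"
  obtain r0 where r0: "r0 > 0" "cball x0 r0 \<subseteq> chart_image c"
    using chart_open(2)[OF cc] open_contains_cball c(2) unfolding x0_def by blast
  have "open (coord d ` (dom_of d \<inter> V))" "y0 \<in> coord d ` (dom_of d \<inter> V)"
    using open_coord_image[OF dd] V d by (auto simp: y0_def)
  then obtain R where R: "R > 0" and RV: "cball y0 R \<subseteq> coord d ` (dom_of d \<inter> V)"
    using open_contains_cball by blast
  have Rd: "cball y0 R \<subseteq> chart_image d" using RV by blast
  obtain M where M: "M > 0" "\<And>x u. x \<in> cball x0 r0 \<Longrightarrow> coord_form g c x u u \<le> M * (norm u)\<^sup>2"
    using riemannian_form_bounds[OF riemannian_form_coord[OF c(1)] compact_cball r0(2)] by metis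
  obtain m where m: "m > 0" "\<And>x u. x \<in> cball y0 R \<Longrightarrow> m * (norm u)\<^sup>2 \<le> coord_form g d x u u"
    using riemannian_form_bounds[OF riemannian_form_coord[OF d(1)] compact_cball Rd] by metis
  define L where "L = sqrt (M / m)"
  have L: "L \<ge> 0" using M m by (simp add: L_def)
  \<comment> \<open>Two points of the ball of radius \<open>\<rho>\<close> are less than
    \<open>2 * \<rho>\<close> apart, and \<open>L\<close> bounds the stretching by \<open>h\<close>.
    The image curve thus moves by at most \<open>R / 4\<close> from a start within
    \<open>R / 2\<close> of \<open>y0\<close>. Adding 1 to \<open>L\<close> keeps the denominator
    positive.\<close>
  define \<rho> where "\<rho> = min r0 (R / (8 * (L + 1)))"
  have \<rho>: "\<rho> > 0" "\<rho> \<le> r0" and \<rho>L: "L * (2 * \<rho>) \<le> R / 4"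
  proof -
    show "\<rho> > 0" "\<rho> \<le> r0" using r0 R L by (auto simp: \<rho>_def)
    have "\<rho> \<le> R / (8 * (L + 1))" by (simp add: \<rho>_def)
    then have "(L + 1) * \<rho> \<le> R / 8" using L by (simp add: field_simps)
    then show "L * (2 * \<rho>) \<le> R / 4" using \<open>\<rho> > 0\<close> by (simp add: algebra_simps)
  qed
  define U where "U = dom_of c \<inter> coord c -` ball x0 \<rho>"
  define V' where "V' = dom_of d \<inter> coord d -` ball y0 (R/2)"
  define W where "W = dom_of d \<inter> coord d -` ball y0 R"
  define K where "K = param d ` cball y0 R"
  have paramK: "compact (param d ` cball y0 s)" if "s \<le> R" for s
    using Rd that by (intro compact_continuous_image continuous_on_subset[OF chart_continuous(2)[OF dd]]) auto
  have WK: "W \<subseteq> K"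
    unfolding W_def K_def by (auto simp: image_iff) (metis less_imp_le mem_cball param_coord[OF dd])
  have "h w \<in> K" if h: "h \<in> isometries A g" and u: "u \<in> U" "h u \<in> V'" and w: "w \<in> U" for h u w
  proof -
    define seg where "seg t = coord c u + t *\<^sub>R (coord c w - coord c u)" for t :: real
    have seg: "seg t \<in> ball x0 \<rho>" if "t \<in> {0..1}" for t
    proof -
      have "seg t = (1 - t) *\<^sub>R coord c u + t *\<^sub>R coord c w" by (simp add: seg_def algebra_simps)
      then show ?thesis using convexD_alt[OF convex_ball, of "coord c u" x0 \<rho> "coord c w" t] u w that by (auto simp: U_def)
    qed
    have segc: "seg t \<in> chart_image c" if "t \<in> {0..1}" for t
      using seg[OF that] \<rho> r0 by auto
    define k where "k t = h (param c (seg t))" for t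
    have ctk: "continuous_on {0..1} k"
      unfolding k_def
    proof (rule continuous_on_compose2[OF isometriesD(2)[OF h]])
      have "continuous_on {0..1} seg" unfolding seg_def by (intro continuous_intros)
      then show "continuous_on {0..1} (\<lambda>t. param c (seg t))"
        by (rule continuous_on_compose2[OF chart_continuous(2)[OF cc]]) (use segc in auto)
    qed auto
    have ends: "k 0 = h u" "k 1 = h w" using u w param_coord[OF cc] by (auto simp: k_def seg_def U_def)
    have "open W" unfolding W_def by (rule open_coord_vimage[OF dd open_ball])
    \<comment> \<open>Its least element \<open>\<tau>\<close> would be the first exit time from
      \<open>W\<close>. Before \<open>\<tau>\<close> the curve stays in the chart \<open>d\<close>,
      where the bound on the derivative applies.\<close>
    define Bad where "Bad = {t \<in> {0..1}. k t \<notin> W}"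
    have "Bad = {}"
    proof (rule ccontr)
      assume "Bad \<noteq> {}"
      have "closed ({0..1} \<inter> k -` (- W))"
        using continuous_closed_preimage[OF ctk closed_atLeastAtMost] \<open>open W\<close> by (simp add: closed_Compl)
      then have "compact ({0..1} \<inter> ({0..1} \<inter> k -` (- W)))" by (intro compact_Int_closed) auto
      moreover have "{0..1} \<inter> ({0..1} \<inter> k -` (- W)) = Bad" by (auto simp: Bad_def)
      ultimately have "compact Bad" by simp
      obtain \<tau> where \<tau>: "\<tau> \<in> Bad" "\<And>t. t \<in> Bad \<Longrightarrow> \<tau> \<le> t"
        using compact_attains_inf[OF \<open>compact Bad\<close> \<open>Bad \<noteq> {}\<close>] by blast
      have "k 0 \<in> W" using u R by (auto simp: ends V'_def W_def)
      then have \<tau>0: "0 < \<tau>" "\<tau> \<le> 1" using \<tau>(1) by (auto simp: Bad_def order_less_le)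
      have kW: "k t \<in> W" if "t \<in> {0..<\<tau>}" for t
        using \<tau>(2)[of t] that \<tau>0 by (force simp: Bad_def)
      let ?\<phi> = "coord d \<circ> h \<circ> param c"
      let ?S = "coord c ` (dom_of c \<inter> h -` dom_of d)"
      have segS: "seg t \<in> ?S" if t: "t \<in> {0..<\<tau>}" for t
      proof -
        have t1: "t \<in> {0..1}" using t \<tau>0 by auto
        have "param c (seg t) \<in> dom_of c \<inter> h -` dom_of d"
          using kW[OF t] param_in_dom[OF cc segc[OF t1]] by (auto simp: k_def W_def)
        then show ?thesis using coord_param[OF cc segc[OF t1]] by (metis image_eqI)
      qed
      define \<psi> where "\<psi> t = coord d (k t)" for t
      have der: "(\<psi> has_derivative (\<lambda>s. dird ?\<phi> (s *\<^sub>R (coord c w - coord c u)) (seg t))) (at t within {0..<\<tau>})"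
        if t: "t \<in> {0..<\<tau>}" for t
      proof -
        have "(seg has_derivative (\<lambda>s. s *\<^sub>R (coord c w - coord c u))) (at t within {0..<\<tau>})"
          unfolding seg_def by (auto intro!: derivative_eq_intros)
        from has_derivative_compose[OF this smooth_on_has_derivative[OF isometry_in_charts(2)[OF h c(1) d(1)] segS[OF t]]]
        show ?thesis by (simp add: \<psi>_def[abs_def] k_def o_def)
      qed
      have mvt: "norm (\<psi> t - \<psi> 0) \<le> (L * (2 * \<rho>)) * norm (t - 0)" if t: "t \<in> {0..<\<tau>}" for t
      proof (rule differentiable_bound[OF _ der _ t])
        fix t assume t: "t \<in> {0..<\<tau>}"
        then have t1: "t \<in> {0..1}" using \<tau>0 by auto
        have "seg t \<in> cball x0 r0" using seg[OF t1] \<rho> by auto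
        moreover have "?\<phi> (seg t) \<in> cball y0 R" using kW[OF t] by (auto simp: k_def W_def)
        ultimately have nb: "norm (dird ?\<phi> v (seg t)) \<le> L * norm v" for v
          unfolding L_def
          by (intro preserves_forms_norm_bound[OF isometry_in_charts(3)[OF h c(1) d(1)] segS[OF t] m(1)] m(2) M(2))
        have "norm (coord c w - coord c u) \<le> 2 * \<rho>"
          using u w dist_triangle_le[of "coord c w" x0 "coord c u" "2 * \<rho>"]
          by (auto simp: U_def dist_norm norm_minus_commute)
        then have n2: "norm (s *\<^sub>R (coord c w - coord c u)) \<le> \<bar>s\<bar> * (2 * \<rho>)" for s
          by (simp add: mult_left_mono)
        show "onorm (\<lambda>s. dird ?\<phi> (s *\<^sub>R (coord c w - coord c u)) (seg t)) \<le> L * (2 * \<rho>)"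
        proof (rule onorm_le)
          fix s :: real
          show "norm (dird ?\<phi> (s *\<^sub>R (coord c w - coord c u)) (seg t)) \<le> L * (2 * \<rho>) * norm s"
            using order_trans[OF nb mult_left_mono[OF n2 L]] by (simp add: mult_ac)
        qed
      qed (use \<tau>0 in auto)
      have \<psi>: "norm (\<psi> t - \<psi> 0) \<le> R / 4" if t: "t \<in> {0..<\<tau>}" for t
      proof -
        have "norm (\<psi> t - \<psi> 0) \<le> (L * (2 * \<rho>)) * \<bar>t\<bar>" using mvt[OF t] by simp
        also have "\<dots> \<le> (R / 4) * 1" using \<rho>L t \<tau>0 R by (intro mult_mono) auto
        finally show ?thesis by simp
      qed
      \<comment> \<open>As \<open>k \<tau>\<close> is not known to lie in the domain of
        \<open>d\<close>, the passage to \<open>\<tau>\<close> takes place in the manifold: the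
        image of the smaller closed ball is compact, hence closed there.\<close>
      have "k ` {0..<\<tau>} \<subseteq> param d ` cball y0 (3 * R / 4)"
      proof
        fix z assume "z \<in> k ` {0..<\<tau>}"
        then obtain t where t: "t \<in> {0..<\<tau>}" "z = k t" by blast
        have "dist y0 (\<psi> 0) \<le> R / 2" using u by (simp add: \<psi>_def ends V'_def)
        moreover have "dist (\<psi> 0) (\<psi> t) \<le> R / 4" using \<psi>[OF t(1)] by (simp add: dist_norm norm_minus_commute)
        ultimately have "\<psi> t \<in> cball y0 (3 * R / 4)" using dist_triangle[of y0 "\<psi> t" "\<psi> 0"] by simp
        moreover have "z = param d (\<psi> t)"
          using kW[OF t(1)] param_coord[OF dd, of z] by (simp add: t(2) \<psi>_def W_def)
        ultimately show "z \<in> param d ` cball y0 (3 * R / 4)" by blast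
      qed
      moreover have "closure {0..<\<tau>} = {0..\<tau>}" using \<tau>0 by simp
      moreover have "closed (param d ` cball y0 (3 * R / 4))" using paramK[of "3 * R / 4"] R compact_imp_closed by auto
      ultimately have "k ` {0..\<tau>} \<subseteq> param d ` cball y0 (3 * R / 4)"
        using image_closure_subset[of "{0..<\<tau>}" k] continuous_on_subset[OF ctk, of "{0..\<tau>}"] \<tau>0 by simp
      then have "k \<tau> \<in> param d ` cball y0 (3 * R / 4)" using \<tau>0 by auto
      then obtain z where z: "z \<in> cball y0 (3 * R / 4)" "k \<tau> = param d z" by blast
      then have "z \<in> ball y0 R" "z \<in> cball y0 R" using R by auto
      moreover have "z \<in> chart_image d" using \<open>z \<in> cball y0 R\<close> Rd by blast
      ultimately have "k \<tau> \<in> W" using coord_param[OF dd] param_in_dom[OF dd] by (simp add: W_def z(2))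
      then show False using \<tau>(1) by (simp add: Bad_def)
    qed
    then have "k 1 \<in> W" by (auto simp: Bad_def)
    then show ?thesis using WK ends by auto
  qed
  moreover have "K \<subseteq> V"
    unfolding K_def using RV param_coord[OF dd] by fastforce
  moreover have "open U" "open V'" unfolding U_def V'_def
    using open_coord_vimage cc dd by blast+
  moreover have "x \<in> U" "y \<in> V'" using c d \<rho> R by (auto simp: U_def V'_def x0_def y0_def)
  moreover have "compact K" unfolding K_def using paramK by simp
  ultimately show "\<exists>U V' K. open U \<and> x \<in> U \<and> open V' \<and> y \<in> V' \<and> compact K \<and> K \<subseteq> V \<and>
        (\<forall>h\<in>isometries A g. \<forall>u\<in>U. h u \<in> V' \<longrightarrow> h ` U \<subseteq> K)"
    by (intro exI[of _ U] exI[of _ V'] exI[of _ K]) blast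
qed

end

section \<open>Even continuity and pointwise convergence\<close>

lemma closure_meets_open:
  "x \<in> closure E \<Longrightarrow> open T \<Longrightarrow> x \<in> T \<Longrightarrow> E \<inter> T \<noteq> {}"
  using open_Int_closure_eq_empty[of T E] by blast

text \<open>The function type carries the product topology, whose basic neighbourhoods constrain
  finitely many values.\<close>

lemma closure_fun_finite:
  fixes F :: "'a \<Rightarrow> 'b::topological_space"
  assumes "F \<in> closure E" "finite X" "\<And>x. x \<in> X \<Longrightarrow> open (O' x)" "\<And>x. x \<in> X \<Longrightarrow> F x \<in> O' x"
  obtains h where "h \<in> E" "\<And>x. x \<in> X \<Longrightarrow> h x \<in> O' x"
proof -
  have "open (\<Inter>x\<in>X. (\<lambda>h. h x) -` O' x)"
    using assms(2,3) by (intro open_INT ballI open_vimage continuous_on_product_coordinates) auto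
  moreover have "F \<in> (\<Inter>x\<in>X. (\<lambda>h. h x) -` O' x)" using assms(4) by auto
  ultimately have "E \<inter> (\<Inter>x\<in>X. (\<lambda>h. h x) -` O' x) \<noteq> {}"
    by (rule closure_meets_open[OF assms(1)])
  then show ?thesis using that by blast
qed

text \<open>If \<open>F w\<close> were outside the closed set \<open>K\<close>, some member of
  \<open>H\<close> would be close to \<open>F\<close> at both \<open>x\<close> and \<open>w\<close>,
  sending \<open>x\<close> into \<open>V'\<close> but \<open>w\<close> outside
  \<open>K\<close>.\<close>

lemma evenly_continuous_closure:
  fixes H :: "('m::t2_space \<Rightarrow> 'm) set"
  assumes "evenly_continuous H" "F \<in> closure H" "open V" "F x \<in> V"
  obtains U V' K where "open U" "x \<in> U" "open V'" "F x \<in> V'" "compact K" "K \<subseteq> V"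
    "\<forall>h\<in>H. \<forall>u\<in>U. h u \<in> V' \<longrightarrow> (\<forall>w\<in>U. h w \<in> K)"
    "\<forall>w\<in>U. F w \<in> K"
proof -
  obtain U V' K where *: "open U" "x \<in> U" "open V'" "F x \<in> V'" "compact K" "K \<subseteq> V"
    and e: "\<forall>h\<in>H. \<forall>u\<in>U. h u \<in> V' \<longrightarrow> (\<forall>w\<in>U. h w \<in> K)"
    by (rule evenly_continuousE[OF assms(1,3,4)])
  have "F w \<in> K" if w: "w \<in> U" for w
  proof (rule ccontr)
    assume F: "F w \<notin> K"
    have oK: "open (- K)" using compact_imp_closed[OF *(5)] by (simp add: open_Compl)
    define O' where "O' z = (if z = x then V' else UNIV) \<inter> (if z = w then - K else UNIV)" for z
    obtain h where h: "h \<in> H" "\<And>z. z \<in> {x, w} \<Longrightarrow> h z \<in> O' z"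
      by (rule closure_fun_finite[OF assms(2), of "{x, w}" O'])
        (use * F oK in \<open>auto simp: O'_def split: if_splits\<close>)
    have "h x \<in> V'" "h w \<notin> K" using h(2)[of x] h(2)[of w] by (auto simp: O'_def split: if_splits)
    then show False using e h(1) *(2) w by blast
  qed
  then have "\<forall>w\<in>U. F w \<in> K" by blast
  from that[OF * e this] show ?thesis .
qed

text \<open>Even continuity controls a whole neighbourhood of each point of \<open>K\<close> by the
  value at that point. A finite subcover then reduces the condition on \<open>K\<close> to
  conditions on finitely many values.\<close>

lemma openin_maps_compact_into_open:
  fixes H :: "('m::t2_space \<Rightarrow> 'm) set"
  assumes H: "evenly_continuous H" and K: "compact K" and U: "open U"
  shows "openin (top_of_set H) {h \<in> H. h ` K \<subseteq> U}"
proof (subst openin_subopen, intro ballI)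
  fix h assume "h \<in> {h \<in> H. h ` K \<subseteq> U}"
  then have h: "h \<in> H" "\<And>x. x \<in> K \<Longrightarrow> h x \<in> U" by auto
  have "\<exists>W V'. open W \<and> x \<in> W \<and> open V' \<and> h x \<in> V' \<and> (\<forall>f\<in>H. f x \<in> V' \<longrightarrow> f ` W \<subseteq> U)" if x: "x \<in> K" for x
  proof -
    obtain W V' C where *: "open W" "x \<in> W" "open V'" "h x \<in> V'" "compact C" "C \<subseteq> U"
      "\<forall>h\<in>H. \<forall>u\<in>W. h u \<in> V' \<longrightarrow> (\<forall>w\<in>W. h w \<in> C)"
      by (rule evenly_continuousE[OF H U h(2)[OF x]])
    have "f w \<in> U" if "f \<in> H" "f x \<in> V'" "w \<in> W" for f w
      using bspec[OF *(7) that(1)] *(2,6) that(2,3) by auto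
    then have "\<forall>f\<in>H. f x \<in> V' \<longrightarrow> f ` W \<subseteq> U" by auto
    with *(1-4) show ?thesis by metis
  qed
  then obtain W V' where WV: "\<And>x. x \<in> K \<Longrightarrow> open (W x) \<and> x \<in> W x \<and> open (V' x) \<and> h x \<in> V' x \<and> (\<forall>f\<in>H. f x \<in> V' x \<longrightarrow> f ` W x \<subseteq> U)"
    by metis
  obtain X where X: "X \<subseteq> K" "finite X" "K \<subseteq> (\<Union>x\<in>X. W x)"
    using compactE_image[OF K, of K W] WV by blast
  define T where "T = (\<Inter>x\<in>X. (\<lambda>h. h x) -` V' x)"
  have "open T" unfolding T_def
    using X WV by (intro open_INT ballI open_vimage continuous_on_product_coordinates) auto
  moreover have "h \<in> T" using WV X by (auto simp: T_def)
  moreover have "f x \<in> U" if f: "f \<in> H" "f \<in> T" and x: "x \<in> K" for f x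
  proof -
    obtain z where z: "z \<in> X" "x \<in> W z" using x X(3) by blast
    then have "f z \<in> V' z" using f by (auto simp: T_def)
    then show ?thesis using WV[of z] z X(1) f(1) by blast
  qed
  then have "H \<inter> T \<subseteq> {h \<in> H. h ` K \<subseteq> U}" by blast
  ultimately show "\<exists>T. openin (top_of_set H) T \<and> h \<in> T \<and> T \<subseteq> {h \<in> H. h ` K \<subseteq> U}"
    using h by (intro exI[of _ "H \<inter> T"]) (auto intro: openin_open_Int)
qed

section \<open>The compact-open topology compared with pointwise convergence\<close>

lemma openin_compact_open:
  "compact K \<Longrightarrow> open U \<Longrightarrow> openin compact_open_topology {f. continuous_on UNIV f \<and> f ` K \<subseteq> U}"
  unfolding compact_open_topology_def by (rule topology_generated_by_Basis) blast

lemma topspace_compact_open: "topspace compact_open_topology = {f. continuous_on UNIV f}"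
proof
  show "topspace compact_open_topology \<subseteq> {f. continuous_on UNIV f}"
    unfolding compact_open_topology_def by (auto simp: topology_generated_by_topspace)
  show "{f. continuous_on UNIV f} \<subseteq> topspace compact_open_topology"
    using openin_subset[OF openin_compact_open[of "{}" UNIV]] by auto
qed

lemma continuous_map_pointwise_compact_open:
  fixes H :: "('m::t2_space \<Rightarrow> 'm) set"
  assumes H: "evenly_continuous H" and cont: "\<And>h. h \<in> H \<Longrightarrow> continuous_on UNIV h"
  shows "continuous_map (top_of_set H) compact_open_topology (\<lambda>h. h)"
  unfolding compact_open_topology_def
proof (rule continuous_on_generated_topo)
  fix B :: "('m \<Rightarrow> 'm) set" assume "B \<in> {{f. continuous_on UNIV f \<and> f ` K \<subseteq> U} |K U. compact K \<and> open U}"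
  then obtain K U where B: "B = {f. continuous_on UNIV f \<and> f ` K \<subseteq> U}" "compact K" "open U" by blast
  have "(\<lambda>h. h) -` B \<inter> topspace (top_of_set H) = {h \<in> H. h ` K \<subseteq> U}"
    using cont by (auto simp: B(1))
  then show "openin (top_of_set H) ((\<lambda>h. h) -` B \<inter> topspace (top_of_set H))"
    using openin_maps_compact_into_open[OF H B(2,3)] by simp
next
  show "(\<lambda>h. h) ` topspace (top_of_set H) \<subseteq> \<Union> {{f. continuous_on UNIV f \<and> f ` K \<subseteq> U} |K U. compact K \<and> open U}"
  proof
    fix h assume "h \<in> (\<lambda>h. h) ` topspace (top_of_set H)"
    then have "h \<in> {f. continuous_on UNIV f \<and> f ` {} \<subseteq> UNIV}" using cont by auto
    then show "h \<in> \<Union> {{f. continuous_on UNIV f \<and> f ` K \<subseteq> U} |K U. compact K \<and> open U}"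
      using compact_empty open_UNIV by blast
  qed
qed

lemma compact_Pi_UNIV:
  fixes C :: "'a \<Rightarrow> 'b::topological_space set"
  assumes "\<And>x. compact (C x)"
  shows "compact {f. \<forall>x. f x \<in> C x}"
proof -
  have "compactin (product_topology (\<lambda>i. euclidean) UNIV) (PiE UNIV C)"
    using assms by (simp add: compactin_PiE)
  moreover have "PiE UNIV C = {f. \<forall>x. f x \<in> C x}" by (auto simp: PiE_def)
  ultimately show ?thesis by (simp add: euclidean_product_topology)
qed

section \<open>Orbits of evenly continuous groups\<close>

locale evenly_continuous_group =
  fixes G :: "('m::t2_space \<Rightarrow> 'm) set"
  assumes connected: "connected (UNIV :: 'm set)"
    and evenly_continuous: "evenly_continuous G"
    and id: "id \<in> G"
    and comp: "h \<in> G \<Longrightarrow> k \<in> G \<Longrightarrow> h \<circ> k \<in> G"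
    and bij: "h \<in> G \<Longrightarrow> bij h"
    and inverse: "h \<in> G \<Longrightarrow> inv_into UNIV h \<in> G"
begin

lemma images_relatively_compact:
  "\<exists>U V' K. open U \<and> x \<in> U \<and> open V' \<and> y \<in> V' \<and> compact K \<and> (\<forall>h\<in>G. \<forall>u\<in>U. h u \<in> V' \<longrightarrow> h ` U \<subseteq> K)"
proof -
  obtain U V' K where "open U" "x \<in> U" "open V'" "y \<in> V'" "compact K" "K \<subseteq> UNIV"
    "\<forall>h\<in>G. \<forall>u\<in>U. h u \<in> V' \<longrightarrow> (\<forall>w\<in>U. h w \<in> K)"
    by (rule evenly_continuousE[OF evenly_continuous open_UNIV UNIV_I])
  then show ?thesis by (intro exI[of _ U] exI[of _ V'] exI[of _ K] conjI ballI impI image_subsetI) auto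
qed

lemma continuous:
  assumes h: "h \<in> G" shows "continuous_on UNIV h"
proof (rule continuous_at_imp_continuous_on, intro ballI)
  fix x
  show "isCont h x"
    unfolding continuous_at_open
  proof (intro allI impI)
    fix V assume V: "open V \<and> h x \<in> V"
    then have "open V" "h x \<in> V" by auto
    then obtain U V' K where "open U" "x \<in> U" "open V'" "h x \<in> V'" "compact K" "K \<subseteq> V"
      "\<forall>k\<in>G. \<forall>u\<in>U. k u \<in> V' \<longrightarrow> (\<forall>w\<in>U. k w \<in> K)"
      by (rule evenly_continuousE[OF evenly_continuous])
    with h show "\<exists>S. open S \<and> x \<in> S \<and> (\<forall>x'\<in>S. h x' \<in> V)" by (intro exI[of _ U]) blast
  qed
qed

text \<open>The set \<open>S\<close> of points whose images under \<open>E\<close> stay in some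
  compact set contains \<open>k\<close>; it is open and closed. Openness follows by covering the
  compact set with finitely many neighbourhoods from even continuity. For closedness, group elements
  with nearby values at a neighbour \<open>x'\<close> of \<open>x\<close> are compared through
  inverses.\<close>

lemma orbits_relatively_compact:
  assumes C: "compact C"
  shows "\<exists>C'. compact C' \<and> (\<forall>h\<in>G. h k \<in> C \<longrightarrow> h x \<in> C')"
proof -
  define E where "E = {h \<in> G. h k \<in> C}"
  define S where "S = {x. \<exists>C'. compact C' \<and> (\<forall>h\<in>E. h x \<in> C')}"
  have "\<exists>T. open T \<and> x \<in> T \<and> T \<subseteq> S" if "x \<in> S" for x
  proof -
    obtain D where D: "compact D" "\<And>h. h \<in> E \<Longrightarrow> h x \<in> D" using \<open>x \<in> S\<close> by (auto simp: S_def)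
    have "\<exists>U V' K. open U \<and> x \<in> U \<and> open V' \<and> y \<in> V' \<and> compact K \<and>
       (\<forall>h\<in>G. \<forall>u\<in>U. h u \<in> V' \<longrightarrow> h ` U \<subseteq> K)" for y
      by (rule images_relatively_compact)
    then obtain U V' K where UVK: "\<And>y. open (U y) \<and> x \<in> U y \<and> open (V' y) \<and> y \<in> V' y \<and> compact (K y) \<and>
       (\<forall>h\<in>G. \<forall>u\<in>U y. h u \<in> V' y \<longrightarrow> h ` U y \<subseteq> K y)" by metis
    obtain Y where Y: "Y \<subseteq> D" "finite Y" "D \<subseteq> (\<Union>y\<in>Y. V' y)"
      using compactE_image[OF D(1), of D V'] UVK by blast
    let ?T = "\<Inter>y\<in>Y. U y"
    have "open ?T" using Y UVK by (intro open_INT) auto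
    moreover have "x \<in> ?T" using UVK by auto
    moreover have "?T \<subseteq> S"
    proof
      fix w assume w: "w \<in> ?T"
      have "compact (\<Union>y\<in>Y. K y)" using Y UVK by (intro compact_UN) auto
      moreover have "h w \<in> (\<Union>y\<in>Y. K y)" if h: "h \<in> E" for h
      proof -
        obtain y where y: "y \<in> Y" "h x \<in> V' y" using D(2)[OF h] Y by blast
        then have "h ` U y \<subseteq> K y" using UVK[of y] h by (auto simp: E_def)
        then show ?thesis using y w by blast
      qed
      ultimately show "w \<in> S" unfolding S_def by blast
    qed
    ultimately show ?thesis by blast
  qed
  then have "open S" by (subst open_subopen) simp
  moreover have "\<exists>T. open T \<and> x \<in> T \<and> T \<subseteq> - S" if "x \<in> - S" for x
  proof -
    \<comment> \<open>Even continuity with source and target both at \<open>x\<close>. It will be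
      applied to the inverse of \<open>h' y\<close> composed with \<open>h\<close>, which sends
      \<open>x'\<close> to a point of \<open>V0\<close>.\<close>
    obtain U0 V0 B where *: "open U0" "x \<in> U0" "open V0" "x \<in> V0" "compact B" "B \<subseteq> UNIV"
      and e: "\<forall>h\<in>G. \<forall>u\<in>U0. h u \<in> V0 \<longrightarrow> (\<forall>w\<in>U0. h w \<in> B)"
      by (rule evenly_continuousE[OF evenly_continuous open_UNIV UNIV_I])
    have "x \<in> S" if x': "x' \<in> U0 \<inter> V0" "x' \<in> S" for x'
    proof -
      obtain D where D: "compact D" "\<And>h. h \<in> E \<Longrightarrow> h x' \<in> D" using x' by (auto simp: S_def)
      have "\<exists>U V'. open U \<and> y \<in> U \<and> x' \<in> V' \<and> (\<forall>h\<in>G. \<forall>u\<in>U. h u \<in> V' \<longrightarrow> h ` U \<subseteq> V0)" for y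
      proof -
        have "x' \<in> V0" using x'(1) by simp
        then obtain U V' K where "open U" "y \<in> U" "open V'" "x' \<in> V'" "compact K" "K \<subseteq> V0"
          "\<forall>h\<in>G. \<forall>u\<in>U. h u \<in> V' \<longrightarrow> (\<forall>w\<in>U. h w \<in> K)"
          by (rule evenly_continuousE[OF evenly_continuous *(3)])
        then show ?thesis by (intro exI[of _ U] exI[of _ V']) blast
      qed
      then obtain U V' where UV: "\<And>y. open (U y) \<and> y \<in> U y \<and> x' \<in> V' y \<and>
         (\<forall>h\<in>G. \<forall>u\<in>U y. h u \<in> V' y \<longrightarrow> h ` U y \<subseteq> V0)" by metis
      obtain Y where Y: "Y \<subseteq> D" "finite Y" "D \<subseteq> (\<Union>y\<in>Y. U y)"
        using compactE_image[OF D(1), of D U] UV by blast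
      \<comment> \<open>One representative for each member of the finite cover that is met by the
        images of \<open>x'\<close> under \<open>E\<close>; for the other members the choice is
        arbitrary, so \<open>?Y\<close> leaves them out. Each \<open>h x\<close> then lies in the
        image of \<open>B\<close> under one of finitely many representatives.\<close>
      define h' where "h' y = (SOME h. h \<in> E \<and> h x' \<in> U y)" for y
      let ?Y = "{y\<in>Y. \<exists>h\<in>E. h x' \<in> U y}"
      have h': "h' y \<in> E" "h' y x' \<in> U y" if "y \<in> ?Y" for y
        using that someI_ex[of "\<lambda>h. h \<in> E \<and> h x' \<in> U y"] unfolding h'_def by auto
      have "compact (\<Union>y\<in>?Y. h' y ` B)"
      proof (rule compact_UN)
        fix y assume "y \<in> ?Y"
        then have "h' y \<in> G" using h' by (auto simp: E_def)
        then show "compact (h' y ` B)"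
          using compact_continuous_image[OF continuous_on_subset[OF continuous]] *(5) by blast
      qed (use Y in auto)
      moreover have "h x \<in> (\<Union>y\<in>?Y. h' y ` B)" if h: "h \<in> E" for h
      proof -
        obtain y where y: "y \<in> Y" "h x' \<in> U y" using D(2)[OF h] Y by blast
        then have yY: "y \<in> ?Y" using h by blast
        note hy = h'[OF yY]
        have hG: "h \<in> G" "h' y \<in> G" using h hy by (auto simp: E_def)
        define j where "j = inv_into UNIV (h' y)"
        have jG: "j \<in> G" using inverse hG by (simp add: j_def)
        have "j (h' y x') = x'" unfolding j_def using bij[OF hG(2)] by (simp add: bij_is_inj)
        then have "j ` U y \<subseteq> V0" using UV[of y] jG hy by metis
        then have "(j \<circ> h) x' \<in> V0" using y by auto
        then have "(j \<circ> h) x \<in> B" using bspec[OF e comp[OF jG hG(1)]] x' *(2) by blast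
        moreover have "h' y ((j \<circ> h) x) = h x"
          unfolding j_def using bij[OF hG(2)] by (simp add: bij_is_surj surj_f_inv_f)
        ultimately show ?thesis using yY by (metis (no_types, lifting) UN_I imageI)
      qed
      ultimately show ?thesis unfolding S_def by blast
    qed
    then show ?thesis using * that by (intro exI[of _ "U0 \<inter> V0"]) auto
  qed
  then have "open (- S)" by (subst open_subopen) simp
  then have "closed S" by (simp add: closed_def)
  moreover have "k \<in> S" using C by (auto simp: S_def E_def)
  ultimately have "S = UNIV" using connected connected_clopen[of UNIV] by auto
  then have "x \<in> S" by simp
  then show ?thesis by (simp add: S_def E_def Ball_def imp_conjL)
qed

text \<open>Finitely many product neighbourhoods cover \<open>K \<times> L\<close>. An element
  moving a point of \<open>K\<close> into \<open>L\<close> therefore sends one of finitely many base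
  points into a given compact set, and the previous lemma applies to each base point.\<close>

lemma orbits_of_compact_relatively_compact:
  assumes K: "compact K" and L: "compact L"
  shows "\<exists>C. compact C \<and> (\<forall>h\<in>G. h ` K \<inter> L \<noteq> {} \<longrightarrow> h x \<in> C)"
proof -
  have "\<exists>U V' C. open U \<and> fst z \<in> U \<and> open V' \<and> snd z \<in> V' \<and> compact C \<and>
     (\<forall>h\<in>G. \<forall>u\<in>U. h u \<in> V' \<longrightarrow> h ` U \<subseteq> C)" for z
    by (rule images_relatively_compact)
  then obtain U V' C where UVC: "\<And>z. open (U z) \<and> fst z \<in> U z \<and> open (V' z) \<and> snd z \<in> V' z \<and> compact (C z) \<and>
     (\<forall>h\<in>G. \<forall>u\<in>U z. h u \<in> V' z \<longrightarrow> h ` U z \<subseteq> C z)" by metis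
  have opUV: "open (U z \<times> V' z)" and inUV: "z \<in> U z \<times> V' z" for z
    using UVC[of z] by (auto intro: open_Times simp: mem_Times_iff)
  have "K \<times> L \<subseteq> (\<Union>z\<in>K \<times> L. U z \<times> V' z)" using inUV by blast
  then obtain Z where Z: "Z \<subseteq> K \<times> L" "finite Z" "K \<times> L \<subseteq> (\<Union>z\<in>Z. U z \<times> V' z)"
    by (rule compactE_image[OF compact_Times[OF K L] opUV])
  have "\<exists>D. compact D \<and> (\<forall>h\<in>G. h (fst z) \<in> C z \<longrightarrow> h x \<in> D)" for z
    by (rule orbits_relatively_compact) (use UVC[of z] in simp)
  then obtain D where D: "\<And>z. compact (D z)" "\<And>z h. h \<in> G \<Longrightarrow> h (fst z) \<in> C z \<Longrightarrow> h x \<in> D z"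
    by metis
  have "compact (\<Union>z\<in>Z. D z)" using Z D by (intro compact_UN) auto
  moreover have "h x \<in> (\<Union>z\<in>Z. D z)" if h: "h \<in> G" "h ` K \<inter> L \<noteq> {}" for h
  proof -
    obtain p where p: "p \<in> K" "h p \<in> L" using h(2) by blast
    then obtain z where z: "z \<in> Z" "p \<in> U z" "h p \<in> V' z" using Z(3) by blast
    then have "h (fst z) \<in> C z" using UVC[of z] h(1) by blast
    then show ?thesis using D(2)[OF h(1)] z by blast
  qed
  ultimately show ?thesis by blast
qed

end

text \<open>Composition is not continuous for pointwise convergence in general. Here even continuity
  helps: if \<open>h\<close> is close to \<open>F\<close> at \<open>F' y\<close> and
  \<open>k y\<close> is close to \<open>F' y\<close>, then \<open>h (k y) = y\<close> lies in a
  compact set that was chosen to avoid \<open>y\<close>.\<close>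

lemma evenly_continuous_limit_inverse:
  fixes H :: "('m::t2_space \<Rightarrow> 'm) set"
  assumes "evenly_continuous H" and FF': "(F, F') \<in> closure {(h, k). h \<in> H \<and> (\<forall>x. h (k x) = x)}"
  shows "F (F' y) = y"
proof (rule ccontr)
  assume "F (F' y) \<noteq> y"
  then obtain V where V: "open V" "F (F' y) \<in> V" "y \<notin> V" using t1_space by blast
  obtain U V' K where *: "open U" "F' y \<in> U" "open V'" "F (F' y) \<in> V'" "compact K" "K \<subseteq> V"
    "\<forall>h\<in>H. \<forall>u\<in>U. h u \<in> V' \<longrightarrow> (\<forall>w\<in>U. h w \<in> K)"
    by (rule evenly_continuousE[OF assms(1) V(1,2)])
  have "open (((\<lambda>h. h (F' y)) -` V') \<times> ((\<lambda>k. k y) -` U))"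
    using * by (intro open_Times open_vimage continuous_on_product_coordinates) auto
  moreover have "(F, F') \<in> ((\<lambda>h. h (F' y)) -` V') \<times> ((\<lambda>k. k y) -` U)" using * by auto
  ultimately have "{(h, k). h \<in> H \<and> (\<forall>x. h (k x) = x)} \<inter> (((\<lambda>h. h (F' y)) -` V') \<times> ((\<lambda>k. k y) -` U)) \<noteq> {}"
    by (rule closure_meets_open[OF FF'])
  then obtain h k where "h \<in> H" "h (k y) = y" "h (F' y) \<in> V'" "k y \<in> U" by blast
  then have "y \<in> K" using *(2,7) by metis
  then show False using V(3) *(6) by blast
qed

section \<open>Pointwise limits of isometries\<close>

context riemannian
begin

lemma isometry_limit_in_charts:
  assumes F: "F \<in> closure (isometries A g)" and c: "c \<in> A" and d: "d \<in> A"
    and p: "p \<in> dom_of c" "F p \<in> dom_of d"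
  shows "\<exists>r>0. smooth_on (coord d \<circ> F \<circ> param c) (ball (coord c p) r) \<and>
    preserves_forms (coord_form g c) (coord_form g d) (coord d \<circ> F \<circ> param c) (ball (coord c p) r)"
proof -
  note cc = chart[OF c] and dd = chart[OF d]
  obtain U V' K where *: "open U" "p \<in> U" "open V'" "F p \<in> V'" "compact K" "K \<subseteq> dom_of d"
    and e: "\<forall>h\<in>isometries A g. \<forall>u\<in>U. h u \<in> V' \<longrightarrow> (\<forall>w\<in>U. h w \<in> K)"
    and FK: "\<forall>w\<in>U. F w \<in> K"
    by (rule evenly_continuous_closure[OF evenly_continuous_isometries F chart_open(1)[OF dd] p(2)])
  have "open (coord c ` (dom_of c \<inter> U))" "coord c p \<in> coord c ` (dom_of c \<inter> U)"
    using open_coord_image[OF cc *(1)] p * by auto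
  then obtain r where r: "r > 0" and rU: "cball (coord c p) r \<subseteq> coord c ` (dom_of c \<inter> U)"
    using open_contains_cball by blast
  define B where "B = cball (coord c p) r"
  have BU: "param c x \<in> dom_of c" "param c x \<in> U" "coord c (param c x) = x" if "x \<in> B" for x
    using rU that param_coord[OF cc] by (auto simp: B_def)
  have BS: "B \<subseteq> chart_image c" using rU by (auto simp: B_def)
  have cB: "compact (param c ` B)"
    using BS by (intro compact_continuous_image continuous_on_subset[OF chart_continuous(2)[OF cc]]) (auto simp: B_def)
  \<comment> \<open>Near each point \<open>q\<close>, both \<open>F\<close> and the isometries close
    to it at \<open>q\<close> stay in one small coordinate ball. Agreement at finitely many points
    thus gives uniform closeness on \<open>B\<close>, and tolerances tending to 0 give a
    sequence.\<close>
  have approx: "\<exists>h. h \<in> isometries A g \<and> h p \<in> V' \<and>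
      (\<forall>x\<in>B. dist (coord d (h (param c x))) (coord d (F (param c x))) < e')" if e': "e' > 0" for e'
  proof -
    have "\<exists>U1 V1. open U1 \<and> q \<in> U1 \<and> open V1 \<and> F q \<in> V1 \<and>
        (\<forall>h\<in>isometries A g. h q \<in> V1 \<longrightarrow> (\<forall>w\<in>U1. dist (coord d (h w)) (coord d (F w)) < e'))"
      if q: "q \<in> param c ` B" for q
    proof -
      let ?V = "dom_of d \<inter> coord d -` ball (coord d (F q)) (e'/2)"
      have "open ?V" by (rule open_coord_vimage[OF dd open_ball])
      moreover have "F q \<in> ?V" using q BU FK *(6) e' by auto
      ultimately obtain U1 V1 K1 where **: "open U1" "q \<in> U1" "open V1" "F q \<in> V1" "compact K1" "K1 \<subseteq> ?V"
        and e1: "\<forall>h\<in>isometries A g. \<forall>u\<in>U1. h u \<in> V1 \<longrightarrow> (\<forall>w\<in>U1. h w \<in> K1)"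
        and F1: "\<forall>w\<in>U1. F w \<in> K1"
        by (rule evenly_continuous_closure[OF evenly_continuous_isometries F])
      have "dist (coord d (h w)) (coord d (F w)) < e'"
        if h: "h \<in> isometries A g" "h q \<in> V1" and w: "w \<in> U1" for h w
      proof -
        have "h w \<in> ?V" "F w \<in> ?V" using e1 h **(2,6) F1 w by blast+
        then show ?thesis
          using dist_triangle_half_r[of "coord d (F q)" "coord d (h w)" e' "coord d (F w)"] by auto
      qed
      then show ?thesis using ** by blast
    qed
    then obtain U1 V1 where UV: "\<And>q. q \<in> param c ` B \<Longrightarrow> open (U1 q) \<and> q \<in> U1 q \<and> open (V1 q) \<and> F q \<in> V1 q \<and>
        (\<forall>h\<in>isometries A g. h q \<in> V1 q \<longrightarrow> (\<forall>w\<in>U1 q. dist (coord d (h w)) (coord d (F w)) < e'))"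
      by metis
    obtain X where X: "X \<subseteq> param c ` B" "finite X" "param c ` B \<subseteq> (\<Union>q\<in>X. U1 q)"
      using compactE_image[OF cB, of "param c ` B" U1] UV by blast
    \<comment> \<open>The constraint at \<open>p\<close> keeps the images of \<open>B\<close> in the
      fixed compact set \<open>K\<close>; the constraints on \<open>X\<close> give the accuracy
      \<open>e'\<close>.\<close>
    define O' where "O' q = (if q = p then V' else UNIV) \<inter> (if q \<in> X then V1 q else UNIV)" for q
    have "open (O' q) \<and> F q \<in> O' q" if "q \<in> insert p X" for q
      using *(3,4) UV[of q] X(1) that unfolding O'_def by (cases "q \<in> X"; cases "q = p") auto
    then obtain h where h: "h \<in> isometries A g" "\<And>q. q \<in> insert p X \<Longrightarrow> h q \<in> O' q"
      using closure_fun_finite[OF F, of "insert p X" O'] X(2) by auto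
    have "h p \<in> V'" using h(2)[of p] by (simp add: O'_def)
    moreover have hV1: "h q \<in> V1 q" if "q \<in> X" for q
      using h(2)[of q] that by (simp add: O'_def)
    have "dist (coord d (h (param c x))) (coord d (F (param c x))) < e'" if x: "x \<in> B" for x
    proof -
      obtain q where q: "q \<in> X" "param c x \<in> U1 q" using x X(3) by blast
      then show ?thesis using UV[of q] X(1) h(1) hV1[OF q(1)] by blast
    qed
    ultimately show ?thesis using h(1) by blast
  qed
  have "\<exists>h. h \<in> isometries A g \<and> h p \<in> V' \<and>
      (\<forall>x\<in>B. dist (coord d (h (param c x))) (coord d (F (param c x))) < inverse (real (Suc n)))" for n
    by (rule approx) simp
  then obtain h where h: "\<And>n. h n \<in> isometries A g" "\<And>n. h n p \<in> V'"
    "\<And>n x. x \<in> B \<Longrightarrow> dist (coord d (h n (param c x))) (coord d (F (param c x))) < inverse (real (Suc n))"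
    by metis
  have hK: "h n (param c x) \<in> K" if "x \<in> B" for n x
    using e h(1,2) *(2) BU(2)[OF that] by blast
  define f where "f n = coord d \<circ> h n \<circ> param c" for n
  have bS: "ball (coord c p) r \<subseteq> coord c ` (dom_of c \<inter> h n -` dom_of d)" for n
  proof
    fix x assume "x \<in> ball (coord c p) r"
    then have "x \<in> B" by (auto simp: B_def)
    then show "x \<in> coord c ` (dom_of c \<inter> h n -` dom_of d)"
      using BU[OF \<open>x \<in> B\<close>] hK[OF \<open>x \<in> B\<close>, of n] *(6) by (intro image_eqI[of _ _ "param c x"]) auto
  qed
  have 1: "smooth_on (f n) (ball (coord c p) r)" for n
    unfolding f_def by (rule smooth_on_subset[OF isometry_in_charts(2)[OF h(1) c d] bS])
  have 2: "preserves_forms (coord_form g c) (coord_form g d) (f n) (ball (coord c p) r)" for n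
    using isometry_in_charts(3)[OF h(1) c d] bS unfolding f_def preserves_forms_def by blast
  have 3: "f n x \<in> coord d ` K" if "x \<in> ball (coord c p) r" for n x
    using hK[of x n] that by (auto simp: f_def B_def)
  have 4: "compact (coord d ` K)"
    using * by (intro compact_continuous_image continuous_on_subset[OF chart_continuous(1)[OF dd]])
  have 5: "uniform_limit (ball (coord c p) r) f (coord d \<circ> F \<circ> param c) sequentially"
    unfolding uniform_limit_iff
  proof (intro allI impI)
    fix e' :: real assume "e' > 0"
    then obtain n0 where n0: "inverse (real (Suc n0)) < e'" using reals_Archimedean by blast
    have "dist (f n x) ((coord d \<circ> F \<circ> param c) x) < e'" if "n \<ge> n0" "x \<in> ball (coord c p) r" for n x
    proof -
      have "x \<in> B" using that by (auto simp: B_def)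
      have "inverse (real (Suc n)) \<le> inverse (real (Suc n0))"
        using that by (intro le_imp_inverse_le) auto
      with h(3)[OF \<open>x \<in> B\<close>, of n] n0
      have "dist (coord d (h n (param c x))) (coord d (F (param c x))) < e'" by linarith
      then show ?thesis by (simp add: f_def)
    qed
    then show "\<forall>\<^sub>F n in sequentially. \<forall>x\<in>ball (coord c p) r. dist (f n x) ((coord d \<circ> F \<circ> param c) x) < e'"
      unfolding eventually_sequentially by blast
  qed
  have 6: "coord d ` K \<subseteq> chart_image d" using * by auto
  note lim = limit_of_isometries[OF chart_open(2)[OF cc] chart_open(2)[OF dd] riemannian_form_coord[OF c]
      riemannian_form_coord[OF d] r BS[unfolded B_def] 4 6 1 3 2 5]
  show ?thesis using lim r by (intro exI[of _ "r/2"]) auto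
qed

lemma smooth_map_isometry_limit:
  assumes F: "F \<in> closure (isometries A g)"
  shows "smooth_map A F"
  unfolding smooth_map_def
proof (intro conjI ballI)
  show "continuous_on UNIV F"
  proof (rule continuous_at_imp_continuous_on, intro ballI)
    fix x
    show "isCont F x"
      unfolding continuous_at_open
    proof (intro allI impI)
      fix V assume V: "open V \<and> F x \<in> V"
      then have "open V" "F x \<in> V" by auto
      then obtain U V' K where "open U" "x \<in> U" "open V'" "F x \<in> V'" "compact K" "K \<subseteq> V"
        "\<forall>h\<in>isometries A g. \<forall>u\<in>U. h u \<in> V' \<longrightarrow> (\<forall>w\<in>U. h w \<in> K)" "\<forall>w\<in>U. F w \<in> K"
        by (rule evenly_continuous_closure[OF evenly_continuous_isometries F])
      then show "\<exists>S. open S \<and> x \<in> S \<and> (\<forall>x'\<in>S. F x' \<in> V)" by blast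
    qed
  qed
  fix c d assume cd: "c \<in> A" "d \<in> A"
  show "smooth_on (coord d \<circ> F \<circ> param c) (coord c ` (dom_of c \<inter> F -` dom_of d))"
    unfolding smooth_on_def
  proof (intro allI times_differentiable_on_local)
    fix k x assume "x \<in> coord c ` (dom_of c \<inter> F -` dom_of d)"
    then obtain p where "p \<in> dom_of c" "F p \<in> dom_of d" "x = coord c p" by auto
    with isometry_limit_in_charts[OF F cd]
    show "\<exists>U. open U \<and> x \<in> U \<and> times_differentiable_on k (coord d \<circ> F \<circ> param c) U"
      unfolding smooth_on_def by (metis centre_in_ball open_ball)
  qed
qed

lemma preserves_metric_isometry_limit:
  assumes F: "F \<in> closure (isometries A g)" and c: "c \<in> A" and d: "d \<in> A"
    and p: "p \<in> dom_of c" "F p \<in> dom_of d"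
  shows "g d (F p) (differential c d F p u) (differential c d F p v) = g c p u v"
proof -
  obtain r where "r > 0" and
    "preserves_forms (coord_form g c) (coord_form g d) (coord d \<circ> F \<circ> param c) (ball (coord c p) r)"
    using isometry_limit_in_charts[OF assms] by blast
  then have "coord_form g d ((coord d \<circ> F \<circ> param c) (coord c p)) (dird (coord d \<circ> F \<circ> param c) u (coord c p))
     (dird (coord d \<circ> F \<circ> param c) v (coord c p)) = coord_form g c (coord c p) u v"
    unfolding preserves_forms_def by auto
  then show ?thesis
    using param_coord[OF chart[OF c] p(1)] param_coord[OF chart[OF d] p(2)]
    by (simp add: coord_form_def differential_def)
qed

text \<open>Both components of the pair are pointwise limits of isometries, so both are smooth, and
  they are inverse to each other. This provides bijectivity of \<open>F\<close> and smoothness of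
  its inverse at once.\<close>

lemma isometry_limit:
  assumes FF': "(F, F') \<in> closure {(h, inv_into UNIV h) |h. h \<in> isometries A g}"
  shows "F \<in> isometries A g" "F' = inv_into UNIV F"
proof -
  let ?Z = "{(h, inv_into UNIV h) |h. h \<in> isometries A g}"
  have fi: "h (inv_into UNIV h x) = x" "inv_into UNIV h (h x) = x" if "h \<in> isometries A g" for h x
    using isometriesD(1)[OF that] by (simp_all add: bij_is_surj surj_f_inv_f bij_is_inj)
  have "fst ` closure ?Z \<subseteq> closure (isometries A g)" "snd ` closure ?Z \<subseteq> closure (isometries A g)"
    using inv_isometry closure_subset
    by (intro image_closure_subset; force intro: continuous_intros)+
  then have F: "F \<in> closure (isometries A g)" and F': "F' \<in> closure (isometries A g)"
    using FF' by force+
  have "?Z \<subseteq> {(h, k). h \<in> isometries A g \<and> (\<forall>x. h (k x) = x)}" using fi by auto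
  then have FF'id: "F (F' y) = y" for y
    using evenly_continuous_limit_inverse[OF evenly_continuous_isometries] FF' closure_mono by blast
  \<comment> \<open>The inverse of an isometry is an isometry, so swapping preserves the set of
    pairs and the previous argument yields the other composition.\<close>
  have "prod.swap ` closure ?Z \<subseteq> closure {(h, k). h \<in> isometries A g \<and> (\<forall>x. h (k x) = x)}"
  proof (rule image_closure_subset)
    show "continuous_on (closure ?Z) prod.swap" by (rule continuous_on_swap)
    have "prod.swap ` ?Z \<subseteq> {(h, k). h \<in> isometries A g \<and> (\<forall>x. h (k x) = x)}" using fi inv_isometry by auto
    then show "prod.swap ` ?Z \<subseteq> closure {(h, k). h \<in> isometries A g \<and> (\<forall>x. h (k x) = x)}"
      using closure_subset by (rule order_trans)
  qed simp
  then have "(F', F) \<in> closure {(h, k). h \<in> isometries A g \<and> (\<forall>x. h (k x) = x)}" using FF' by force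
  then have F'Fid: "F' (F x) = x" for x
    by (rule evenly_continuous_limit_inverse[OF evenly_continuous_isometries])
  have "bij F" using FF'id F'Fid by (metis bijI')
  show F'inv: "F' = inv_into UNIV F"
    using F'Fid \<open>bij F\<close> FF'id by (metis bij_inv_eq_iff ext)
  show "F \<in> isometries A g"
    using \<open>bij F\<close> smooth_map_isometry_limit[OF F] smooth_map_isometry_limit[OF F'] preserves_metric_isometry_limit[OF F]
    unfolding isometries_def F'inv by auto
qed

end

section \<open>Closed subgroups and proper actions\<close>

context riemannian
begin

section \<open>The isometry group and its topology\<close>

lemma topspace_isometry_topology: "topspace (isometry_topology A g) = isometries A g"
  using isometriesD(2) by (auto simp: isometry_topology_def topspace_compact_open)

lemma openin_isometry_topology:
  assumes "compact K" "open U"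
  shows "openin (isometry_topology A g) {h \<in> isometries A g. h ` K \<subseteq> U}"
proof -
  have "{h \<in> isometries A g. h ` K \<subseteq> U} = {f. continuous_on UNIV f \<and> f ` K \<subseteq> U} \<inter> isometries A g"
    using isometriesD(2) by blast
  then show ?thesis
    unfolding isometry_topology_def using openin_compact_open[OF assms] by (auto simp: openin_subtopology)
qed

lemma openin_isometry_topology_point:
  "open U \<Longrightarrow> openin (isometry_topology A g) {h \<in> isometries A g. h x \<in> U}"
  using openin_isometry_topology[of "{x}" U] by simp

lemma continuous_map_pointwise_isometry_topology:
  "continuous_map (top_of_set (isometries A g)) (isometry_topology A g) (\<lambda>h. h)"
  unfolding isometry_topology_def
  using continuous_map_pointwise_compact_open[OF evenly_continuous_isometries isometriesD(2)]
  by (auto simp: continuous_map_in_subtopology)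

lemma Hausdorff_isometry_topology: "Hausdorff_space (isometry_topology A g)"
  unfolding Hausdorff_space_def topspace_isometry_topology
proof (intro allI impI)
  fix f h assume "f \<in> isometries A g \<and> h \<in> isometries A g \<and> f \<noteq> h"
  then obtain x where fh: "f \<in> isometries A g" "h \<in> isometries A g" and "f x \<noteq> h x" by auto
  obtain U V where UV: "open U" "open V" "f x \<in> U" "h x \<in> V" "U \<inter> V = {}"
    using hausdorff[OF \<open>f x \<noteq> h x\<close>] by blast
  show "\<exists>U V. openin (isometry_topology A g) U \<and> openin (isometry_topology A g) V \<and> f \<in> U \<and> h \<in> V \<and> disjnt U V"
    using openin_isometry_topology_point[OF UV(1), of x] openin_isometry_topology_point[OF UV(2), of x] UV fh
    by (intro exI[of _ "{h \<in> isometries A g. h x \<in> U}"] exI[of _ "{h \<in> isometries A g. h x \<in> V}"])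
      (auto simp: disjnt_def)
qed

lemma m_inv_isometry_group:
  assumes f: "f \<in> isometries A g"
  shows "m_inv (isometry_group A g) f = inv_into UNIV f"
  unfolding m_inv_def
proof (rule the_equality)
  have b: "bij f" using isometriesD(1)[OF f] .
  then show "inv_into UNIV f \<in> carrier (isometry_group A g) \<and>
    f \<otimes>\<^bsub>isometry_group A g\<^esub> inv_into UNIV f = \<one>\<^bsub>isometry_group A g\<^esub> \<and>
    inv_into UNIV f \<otimes>\<^bsub>isometry_group A g\<^esub> f = \<one>\<^bsub>isometry_group A g\<^esub>"
    using inv_isometry[OF f]
    by (auto simp: isometry_group_def fun_eq_iff bij_is_surj surj_f_inv_f bij_is_inj)
  fix k assume "k \<in> carrier (isometry_group A g) \<and>
    f \<otimes>\<^bsub>isometry_group A g\<^esub> k = \<one>\<^bsub>isometry_group A g\<^esub> \<and>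
    k \<otimes>\<^bsub>isometry_group A g\<^esub> f = \<one>\<^bsub>isometry_group A g\<^esub>"
  then have "f \<circ> k = id" "k \<circ> f = id" by (auto simp: isometry_group_def)
  then show "k = inv_into UNIV f" by (metis inv_unique_comp)
qed

lemma evenly_continuous_group_subgroup:
  assumes "connected (UNIV :: 'm set)" and G: "subgroup G (isometry_group A g)"
  shows "evenly_continuous_group G"
proof
  have GI: "G \<subseteq> isometries A g" using subgroup.subset[OF G] by (simp add: isometry_group_def)
  then show "evenly_continuous G" using evenly_continuous_subset[OF evenly_continuous_isometries] by blast
  show "id \<in> G" using subgroup.one_closed[OF G] by (simp add: isometry_group_def)
  show "h \<circ> k \<in> G" if "h \<in> G" "k \<in> G" for h k
    using subgroup.m_closed[OF G that] by (simp add: isometry_group_def)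
  fix h assume "h \<in> G"
  then have h: "h \<in> isometries A g" using GI by blast
  show "bij h" by (rule isometriesD(1)[OF h])
  show "inv_into UNIV h \<in> G"
    using subgroup.m_inv_closed[OF G \<open>h \<in> G\<close>] m_inv_isometry_group[OF h] by simp
qed fact

text \<open>The pairs with inverses form a closed subset of a product of compact sets, hence a
  compact set. Projecting to the first component and passing from pointwise convergence to the
  compact-open topology are continuous.\<close>

lemma compact_transporter:
  assumes conn: "connected (UNIV :: 'm set)" and G: "subgroup G (isometry_group A g)"
    and closed: "closedin (isometry_topology A g) G" and K: "compact K" and L: "compact L"
  shows "compactin (isometry_topology A g) {h \<in> G. h ` K \<inter> L \<noteq> {}}"
proof -
  interpret evenly_continuous_group G by (rule evenly_continuous_group_subgroup[OF conn G])
  have GI: "G \<subseteq> isometries A g" using subgroup.subset[OF G] by (simp add: isometry_group_def)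
  let ?E = "{h \<in> G. h ` K \<inter> L \<noteq> {}}"
  define Z where "Z = {(h, inv_into UNIV h) |h. h \<in> ?E}"
  have fstZ: "fst ` Z = ?E" by (force simp: Z_def)
  have "closure Z \<subseteq> Z"
  proof
    fix z assume z: "z \<in> closure Z"
    obtain F F' where zF: "z = (F, F')" by (cases z)
    have "Z \<subseteq> {(h, inv_into UNIV h) |h. h \<in> isometries A g}" using GI by (auto simp: Z_def)
    then have "(F, F') \<in> closure {(h, inv_into UNIV h) |h. h \<in> isometries A g}"
      using closure_mono z zF by blast
    note F = isometry_limit[OF this]
    have "fst ` closure Z \<subseteq> closure (fst ` Z)"
      by (rule image_closure_subset) (auto intro: continuous_intros closure_subset[THEN subsetD])
    then have FE: "F \<in> closure ?E" unfolding fstZ using z zF by force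
    \<comment> \<open>Closedness in the compact-open topology is pulled back along the continuous
      identity map from the topology of pointwise convergence.\<close>
    have "closedin (top_of_set (isometries A g)) {h \<in> topspace (top_of_set (isometries A g)). h \<in> G}"
      using closedin_continuous_map_preimage[OF continuous_map_pointwise_isometry_topology closed] .
    then have "closedin (top_of_set (isometries A g)) G"
      using GI by (simp add: Int_absorb1 Collect_conj_eq)
    then obtain T where T: "closed T" "G = isometries A g \<inter> T" by (auto simp: closedin_closed)
    have "closure ?E \<subseteq> T" using T by (intro closure_minimal) auto
    then have FG: "F \<in> G" using T FE F(1) by blast
    \<comment> \<open>Missing \<open>L\<close> means mapping the compact set \<open>K\<close> into
      the open set \<open>- L\<close>, an open condition; if it held for the limit, it would hold
      for some member of \<open>?E\<close>.\<close>
    have "F ` K \<inter> L \<noteq> {}"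
    proof
      assume "F ` K \<inter> L = {}"
      moreover obtain T where T: "open T" "{h \<in> isometries A g. h ` K \<subseteq> - L} = isometries A g \<inter> T"
        using openin_maps_compact_into_open[OF evenly_continuous_isometries K, of "- L"]
          compact_imp_closed[OF L] by (auto simp: openin_open open_Compl)
      ultimately have "F \<in> T" using F(1) by blast
      then obtain h where "h \<in> ?E" "h \<in> T" using closure_meets_open[OF FE T(1)] by blast
      then show False using T(2) GI by blast
    qed
    then show "z \<in> Z" using FG F(2) by (simp add: Z_def zF)
  qed
  then have "closed Z" using closure_subset_eq by blast
  have "\<exists>C. compact C \<and> (\<forall>h\<in>G. h ` K \<inter> L \<noteq> {} \<longrightarrow> h x \<in> C)" for x
    by (rule orbits_of_compact_relatively_compact[OF K L])
  then obtain C where C: "\<And>x. compact (C x)" "\<And>x h. h \<in> G \<Longrightarrow> h ` K \<inter> L \<noteq> {} \<Longrightarrow> h x \<in> C x" by metis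
  have "\<exists>C. compact C \<and> (\<forall>h\<in>G. h ` L \<inter> K \<noteq> {} \<longrightarrow> h x \<in> C)" for x
    by (rule orbits_of_compact_relatively_compact[OF L K])
  then obtain C' where C': "\<And>x. compact (C' x)" "\<And>x h. h \<in> G \<Longrightarrow> h ` L \<inter> K \<noteq> {} \<Longrightarrow> h x \<in> C' x" by metis
  \<comment> \<open>Inversion exchanges the roles of \<open>K\<close> and \<open>L\<close>, so the
    inverses have relatively compact orbits as well, with bounds \<open>C'\<close>.\<close>
  have inv: "inv_into UNIV h ` L \<inter> K \<noteq> {}" "inv_into UNIV h \<in> G" if h: "h \<in> ?E" for h
  proof -
    obtain p where p: "p \<in> K" "h p \<in> L" using h by blast
    have "inv_into UNIV h (h p) = p" using bij h by (simp add: bij_is_inj)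
    then have "p \<in> inv_into UNIV h ` L" using p(2) by (metis imageI)
    then show "inv_into UNIV h ` L \<inter> K \<noteq> {}" using p(1) by blast
    show "inv_into UNIV h \<in> G" using inverse h by blast
  qed
  have Zsub: "Z \<subseteq> {f. \<forall>x. f x \<in> C x} \<times> {f. \<forall>x. f x \<in> C' x}"
    using C(2) C'(2)[OF inv(2) inv(1)] unfolding Z_def by blast
  have "compact ({f. \<forall>x. f x \<in> C x} \<times> {f. \<forall>x. f x \<in> C' x})"
    using C(1) C'(1) by (intro compact_Times compact_Pi_UNIV)
  from compact_Int_closed[OF this \<open>closed Z\<close>] have "compact Z" by (simp only: Int_absorb1[OF Zsub])
  then have "compact ?E" unfolding fstZ[symmetric] by (intro compact_continuous_image continuous_intros)
  then have "compactin (top_of_set (isometries A g)) ?E" using GI by (auto simp: compactin_subtopology)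
  from image_compactin[OF this continuous_map_pointwise_isometry_topology] show ?thesis by simp
qed

section \<open>Properness of the action and closedness of the group\<close>

lemma manifold_locally_compact:
  obtains O' C where "open O'" "(x::'m) \<in> O'" "compact C" "O' \<subseteq> C"
proof -
  obtain c where c: "c \<in> A" "x \<in> dom_of c" by (rule chart_at)
  note cc = chart[OF c(1)]
  obtain r where r: "r > 0" "cball (coord c x) r \<subseteq> chart_image c"
    using chart_open(2)[OF cc] open_contains_cball c(2) by blast
  show ?thesis
  proof (rule that)
    show "open (dom_of c \<inter> coord c -` ball (coord c x) r)" by (rule open_coord_vimage[OF cc open_ball])
    show "x \<in> dom_of c \<inter> coord c -` ball (coord c x) r" using c r by simp
    show "compact (param c ` cball (coord c x) r)"
      using r by (intro compact_continuous_image continuous_on_subset[OF chart_continuous(2)[OF cc]]) auto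
    show "dom_of c \<inter> coord c -` ball (coord c x) r \<subseteq> param c ` cball (coord c x) r"
    proof
      fix p assume "p \<in> dom_of c \<inter> coord c -` ball (coord c x) r"
      then show "p \<in> param c ` cball (coord c x) r"
        using param_coord[OF cc] by (intro image_eqI[of _ _ "coord c p"]) auto
    qed
  qed
qed

lemma locally_compact_space_manifold: "locally_compact_space (euclidean :: 'm topology)"
  unfolding locally_compact_space_def
  using manifold_locally_compact by (metis compactin_euclidean_iff open_openin)

text \<open>Evaluation is jointly continuous, as even continuity turns closeness of transformations
  at a single point into control on a neighbourhood of it.\<close>

lemma continuous_map_action:
  assumes GI: "G \<subseteq> isometries A g"
  shows "continuous_map (prod_topology (subtopology (isometry_topology A g) G) euclidean)
    (prod_topology euclidean euclidean) (\<lambda>(h, p). (h p, p))"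
proof -
  let ?X = "prod_topology (subtopology (isometry_topology A g) G) (euclidean :: 'm topology)"
  have top: "topspace ?X = G \<times> UNIV"
    using GI by (auto simp: topspace_isometry_topology)
  have "continuous_map ?X euclidean (\<lambda>z. fst z (snd z))"
    unfolding continuous_map_eq_topcontinuous_at topcontinuous_at_def
  proof (intro ballI conjI allI impI)
    fix z V assume z: "z \<in> topspace ?X" and V: "openin euclidean V \<and> fst z (snd z) \<in> V"
    then have hG: "fst z \<in> G" "open V" "fst z (snd z) \<in> V" using top by auto
    obtain U V' K where *: "open U" "snd z \<in> U" "open V'" "fst z (snd z) \<in> V'" "compact K" "K \<subseteq> V"
      "\<forall>h\<in>isometries A g. \<forall>u\<in>U. h u \<in> V' \<longrightarrow> (\<forall>w\<in>U. h w \<in> K)"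
      by (rule evenly_continuousE[OF evenly_continuous_isometries hG(2,3)])
    let ?W = "({h \<in> isometries A g. h (snd z) \<in> V'} \<inter> G) \<times> U"
    have "openin ?X ?W"
      using openin_isometry_topology_point[OF *(3), of "snd z"] *(1)
      by (intro openin_prod_Times_iff[THEN iffD2] disjI2 conjI) (auto simp: openin_subtopology)
    moreover have "z \<in> ?W" using hG GI * by (auto simp: mem_Times_iff)
    moreover have "fst y (snd y) \<in> V" if y: "y \<in> ?W" for y
    proof -
      have "fst y \<in> isometries A g" "fst y (snd z) \<in> V'" "snd y \<in> U" using y by auto
      then show ?thesis using *(2,6,7) by blast
    qed
    ultimately show "\<exists>W. openin ?X W \<and> z \<in> W \<and> (\<forall>y\<in>W. fst y (snd y) \<in> V)" by blast
  qed auto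
  then have "continuous_map ?X (prod_topology euclidean euclidean) (\<lambda>z. (fst z (snd z), snd z))"
    by (intro continuous_map_pairedI continuous_map_snd)
  then show ?thesis by (simp add: split_def)
qed

lemma acts_properly_if_closedin:
  assumes conn: "connected (UNIV :: 'm set)" and G: "subgroup G (isometry_group A g)"
    and closed: "closedin (isometry_topology A g) G"
  shows "acts_properly (subtopology (isometry_topology A g) G)"
proof -
  let ?T = "subtopology (isometry_topology A g) G"
  let ?X = "prod_topology ?T (euclidean :: 'm topology)"
  let ?P = "\<lambda>(h, p). (h p, p) :: 'm \<times> 'm"
  have GI: "G \<subseteq> isometries A g" using subgroup.subset[OF G] by (simp add: isometry_group_def)
  note cont = continuous_map_action[OF GI]
  have top: "topspace ?X = G \<times> UNIV" using GI by (auto simp: topspace_isometry_topology)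
  have H: "Hausdorff_space (prod_topology euclidean euclidean :: ('m \<times> 'm) topology)"
    unfolding prod_topology_euclidean Hausdorff_space_def disjnt_def using hausdorff[where 'a="'m \<times> 'm"] by simp
  have lc: "locally_compact_space (prod_topology euclidean euclidean :: ('m \<times> 'm) topology)"
    using locally_compact_space_manifold locally_compact_space_prod_topology by blast
  have "compactin ?X {z \<in> topspace ?X. ?P z \<in> D}" if D: "compactin (prod_topology euclidean euclidean) D" for D
  proof -
    have cD: "compact D" using D by simp
    let ?E = "{h \<in> G. h ` (snd ` D) \<inter> fst ` D \<noteq> {}}"
    have "compactin (isometry_topology A g) ?E"
      using cD by (intro compact_transporter[OF conn G closed] compact_continuous_image continuous_intros)
    then have "compactin ?T ?E" by (auto simp: compactin_subtopology)
    then have "compactin ?X (?E \<times> snd ` D)"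
      using compact_continuous_image[OF continuous_on_snd[OF continuous_on_id] cD] by (simp add: compactin_Times)
    moreover have "{z \<in> topspace ?X. ?P z \<in> D} \<subseteq> ?E \<times> snd ` D"
      unfolding top by force
    moreover have "closedin ?X {z \<in> topspace ?X. ?P z \<in> D}"
      by (rule closedin_continuous_map_preimage[OF cont compactin_imp_closedin[OF H D]])
    ultimately show ?thesis by (rule closed_compactin)
  qed
  then show ?thesis
    unfolding acts_properly_def
    using proper_eq_compact_map[OF locally_compact_imp_k_space[OF lc] Hausdorff_imp_kc_space[OF H], of ?X ?P] cont
    by auto
qed

lemma closedin_if_acts_properly:
  assumes GI: "G \<subseteq> isometries A g" and proper: "acts_properly (subtopology (isometry_topology A g) G)"
  shows "closedin (isometry_topology A g) G"
proof -
  let ?I = "isometry_topology A g" and ?X = "prod_topology (subtopology (isometry_topology A g) G) (euclidean :: 'm topology)"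
  have top: "topspace ?X = G \<times> UNIV" using GI by (auto simp: topspace_isometry_topology)
  have "F \<in> G" if F: "F \<in> ?I closure_of G" for F
  proof -
    have FI: "F \<in> isometries A g" using F closure_of_subset_topspace[of ?I G] topspace_isometry_topology by blast
    \<comment> \<open>Any single point will do: the preimage of \<open>L \<times> {p}\<close>
      projects onto the elements of \<open>G\<close> sending \<open>p\<close> into \<open>L\<close>,
      and openness of \<open>?N\<close> ensures that \<open>F\<close> is already a limit of such
      elements.\<close>
    fix p :: 'm
    obtain O' L where OL: "open O'" "F p \<in> O'" "compact L" "O' \<subseteq> L" by (rule manifold_locally_compact)
    have "compactin (prod_topology euclidean euclidean) (L \<times> {p})" using OL(3) by (simp add: compact_Times)
    with proper have "compactin ?X {z \<in> topspace ?X. (\<lambda>(h, p). (h p, p)) z \<in> L \<times> {p}}"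
      unfolding acts_properly_def by (rule compactin_proper_map_preimage)
    from image_compactin[OF this continuous_map_fst]
    have "compactin ?I (fst ` {z \<in> topspace ?X. (\<lambda>(h, p). (h p, p)) z \<in> L \<times> {p}})"
      by (simp add: compactin_subtopology)
    moreover have "fst ` {z \<in> topspace ?X. (\<lambda>(h, p). (h p, p)) z \<in> L \<times> {p}} = {h \<in> G. h p \<in> L}"
      unfolding top by force
    ultimately have closed: "closedin ?I {h \<in> G. h p \<in> L}"
      using compactin_imp_closedin[OF Hausdorff_isometry_topology] by simp
    let ?N = "{h \<in> isometries A g. h p \<in> O'}"
    have "F \<in> ?N \<inter> ?I closure_of G" using F FI OL by simp
    then have "F \<in> ?I closure_of (?N \<inter> G)"
      using openin_Int_closure_of_subset[OF openin_isometry_topology_point[OF OL(1)]] by blast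
    also have "\<dots> \<subseteq> {h \<in> G. h p \<in> L}" using OL(4) by (intro closure_of_minimal closed) auto
    finally show ?thesis by simp
  qed
  then show ?thesis using closure_of_subset_eq[of G ?I] GI topspace_isometry_topology by blast
qed

end

theorem theorem4:
  fixes A :: "('m::{second_countable_topology,t2_space}, 'e::euclidean_space) chart set"
    and g :: "('m, 'e) metric_tensor"
    and G :: "('m \<Rightarrow> 'm) set"
  assumes "riemannian_manifold A g"
    and "connected (UNIV :: 'm set)"
    and "complete_riemannian A g"
    and "subgroup G (isometry_group A g)"
  shows "acts_properly (subtopology (isometry_topology A g) G) \<longleftrightarrow>
         closedin (isometry_topology A g) G"
proof -
  interpret riemannian A g by unfold_locales fact
  have "G \<subseteq> isometries A g" using subgroup.subset[OF assms(4)] by (simp add: isometry_group_def)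
  then show ?thesis
    using acts_properly_if_closedin[OF assms(2,4)] closedin_if_acts_properly by blast
qed

end
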